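(* Fix $K$, the precisions $\tau_\theta,\tau_g,\tau_y>0$ and the payoff parameters $\psi_t,c_t\in\mathbb R$, $\xi_t>0$, $0<d_t<\beta_t$. For each provider-share vector $x=(x_1,\dots,x_K)$ with $x_k\ge 0$ and $\sum_k x_k=1$, consider the (unique) affine delegated equilibrium $a_{kt}=\alpha_t+\gamma_{kt}m_{kt}$, the aggregate action $A_t=\sum_{k}x_ka_{kt}$ and the common-response coefficient $\mathcal S_t=\sum_k x_k\gamma_{kt}$. Then under any majorization-increasing change of the provider-share vector (i.e. replacing $x$ by a share vector $x'$ that majorizes $x$): (i) the unconditional mean action $\mathbb E[A_t]=\alpha_t$ is invariant; (ii) $\mathcal S_t$, and therefore $\mathrm{Cov}(A_t,\theta_t)$, is weakly increasing; (iii) the common component $\rho_t\mathcal V_t\mathcal S_t^2$ and the total variance $\mathrm{Var}(A_t)$ are weakly increasing. Moreover, for $K\ge 2$, along the dominant-provider family $$x(x_D)=\Bigl(x_D,\tfrac{1-x_D}{K-1},\dots,\tfrac{1-x_D}{K-1}\Bigr),\qquad x_D\in[1/K,1],$$ the increases in (ii) and (iii) are strict in $x_D$ for interior $x_D\in(1/K,1)$: $\mathcal S_t$, $\mathrm{Cov}(A_t,\theta_t)$, $\rho_t\mathcal V_t\mathcal S_t^2$ and $\mathrm{Var}(A_t)$ are strictly increasing in $x_D$ there.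
   Context: Signals. The scarcity state is $\theta_t\sim\mathcal N(0,\tau_\theta^{-1})$. All providers $k=1,\dots,K$ observe the public signal $g_t=\theta_t+\eta_{0t}$, and provider $k$ also observes $y_{kt}=\theta_t+\eta_{kt}$, where $\eta_{0t}\sim\mathcal N(0,\tau_g^{-1})$, $\eta_{kt}\sim\mathcal N(0,\tau_y^{-1})$, all noises are mutually independent and independent of $\theta_t$. Provider $k$'s posterior mean is $m_{kt}:=\mathbb E[\theta_t\mid g_t,y_{kt}]$. Put $T:=\tau_\theta+\tau_g+\tau_y$, $\mathcal V_t:=\mathrm{Var}(m_{kt})=\frac{\tau_g+\tau_y}{\tau_\theta T}$, and $\rho_t:=1-\frac{\tau_\theta\tau_y}{(\tau_g+\tau_y)T}\in(0,1)$, which for $j\ne k$ equals $\mathrm{Cov}(m_{kt},m_{jt})/\mathrm{Var}(m_{kt})$. Game. Provider $k$ controls share $x_k\ge0$, $\sum_kx_k=1$. All clients of provider $k$ receive $m_{kt}$ and choose the same scalar action $a_{kt}$; $A_t:=\sum_kx_ka_{kt}$. The payoff of a provider-$k$ client from action $a$ is $$\Pi_{kt}(a\mid m_{kt})=(a-c_t)\bigl(\psi_t+\xi_tm_{kt}-\beta_ta+d_t\,\mathbb E[A_t\mid m_{kt}]\bigr),$$ where an individual client takes $\mathbb E[A_t\mid m_{kt}]$ as given (it does not vary with the client's own $a$). An affine delegated equilibrium is a vector $(\alpha_{kt},\gamma_{kt})_{k=1}^K$ of real numbers such that every client of provider $k$ chooses $a_{kt}=\alpha_{kt}+\gamma_{kt}m_{kt}$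 and this action maximizes $\Pi_{kt}(\cdot\mid m_{kt})$. It is unique, with $\alpha_{kt}=\alpha_t=\frac{\psi_t+\beta_tc_t}{2\beta_t-d_t}$ for all $k$ and $$\gamma_{kt}=\frac{\xi_t}{1-d_t\rho_t\Lambda_t(x)}\,\frac1{2\beta_t-d_t(1-\rho_t)x_k},\qquad \Lambda_t(x)=\sum_{k=1}^K\frac{x_k}{2\beta_t-d_t(1-\rho_t)x_k}.$$ A vector $x'$ majorizes $x$ if, for each $n\le K$, the sum of the $n$ largest entries of $x'$ is at least that of $x$, with equality for $n=K$. *)

theory Defs
  imports "HOL-Probability.Probability"
begin

text \<open>
  The model is static: the time index is suppressed throughout. Providers are numbered
  \<open>1, \<dots>, K\<close>; vectors indexed by providers are functions on \<^typ>\<open>nat\<close>, of which only the values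
  on \<open>{1..K}\<close> matter.
\<close>

definition cov :: "'a measure \<Rightarrow> ('a \<Rightarrow> real) \<Rightarrow> ('a \<Rightarrow> real) \<Rightarrow> real" where
  "cov M X Y = (\<integral>\<omega>. (X \<omega> - (\<integral>\<omega>'. X \<omega>' \<partial>M)) * (Y \<omega> - (\<integral>\<omega>'. Y \<omega>' \<partial>M)) \<partial>M)"

definition cond_expectation_given ::
    "'a measure \<Rightarrow> 'b measure \<Rightarrow> ('a \<Rightarrow> 'b) \<Rightarrow> ('a \<Rightarrow> real) \<Rightarrow> 'a \<Rightarrow> real" where
  "cond_expectation_given M N Z X = real_cond_exp M (vimage_algebra (space M) Z N) X"

text \<open>
  \<open>\<eta> 0\<close> is the noise of the public signal and \<open>\<eta> k\<close>, for \<open>k \<in> {1..K}\<close>, the noise of the private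
  signal of provider \<open>k\<close>. Joint independence of the state and all noises is stated for one family
  in which \<^const>\<open>None\<close> indexes the state. The second parameter of \<^const>\<open>normal_density\<close> is the
  standard deviation, hence \<open>1 / sqrt \<tau>\<close> for precision \<open>\<tau>\<close>.
\<close>

definition signal_structure ::
    "'a measure \<Rightarrow> nat \<Rightarrow> real \<Rightarrow> real \<Rightarrow> real \<Rightarrow> ('a \<Rightarrow> real) \<Rightarrow> (nat \<Rightarrow> 'a \<Rightarrow> real) \<Rightarrow> bool" where
  "signal_structure M K \<tau>\<^sub>\<theta> \<tau>\<^sub>g \<tau>\<^sub>y \<theta> \<eta> \<longleftrightarrow>
     prob_space M \<and>
     distributed M lborel \<theta> (normal_density 0 (1 / sqrt \<tau>\<^sub>\<theta>)) \<and>
     distributed M lborel (\<eta> 0) (normal_density 0 (1 / sqrt \<tau>\<^sub>g)) \<and>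
     (\<forall>k\<in>{1..K}. distributed M lborel (\<eta> k) (normal_density 0 (1 / sqrt \<tau>\<^sub>y))) \<and>
     prob_space.indep_vars M (\<lambda>_. borel) (\<lambda>i. case i of None \<Rightarrow> \<theta> | Some k \<Rightarrow> \<eta> k)
       (insert None (Some ` {0..K}))"

definition public_signal :: "('a \<Rightarrow> real) \<Rightarrow> (nat \<Rightarrow> 'a \<Rightarrow> real) \<Rightarrow> 'a \<Rightarrow> real" where
  "public_signal \<theta> \<eta> \<omega> = \<theta> \<omega> + \<eta> 0 \<omega>"

definition private_signal :: "('a \<Rightarrow> real) \<Rightarrow> (nat \<Rightarrow> 'a \<Rightarrow> real) \<Rightarrow> nat \<Rightarrow> 'a \<Rightarrow> real" where
  "private_signal \<theta> \<eta> k \<omega> = \<theta> \<omega> + \<eta> k \<omega>"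

definition posterior_mean ::
    "'a measure \<Rightarrow> ('a \<Rightarrow> real) \<Rightarrow> (nat \<Rightarrow> 'a \<Rightarrow> real) \<Rightarrow> nat \<Rightarrow> 'a \<Rightarrow> real" where
  "posterior_mean M \<theta> \<eta> k =
     cond_expectation_given M (borel \<Otimes>\<^sub>M borel)
       (\<lambda>\<omega>. (public_signal \<theta> \<eta> \<omega>, private_signal \<theta> \<eta> k \<omega>)) \<theta>"

definition posterior_corr :: "real \<Rightarrow> real \<Rightarrow> real \<Rightarrow> real" where
  "posterior_corr \<tau>\<^sub>\<theta> \<tau>\<^sub>g \<tau>\<^sub>y = 1 - \<tau>\<^sub>\<theta> * \<tau>\<^sub>y / ((\<tau>\<^sub>g + \<tau>\<^sub>y) * (\<tau>\<^sub>\<theta> + \<tau>\<^sub>g + \<tau>\<^sub>y))"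

definition share_vector :: "nat \<Rightarrow> (nat \<Rightarrow> real) \<Rightarrow> bool" where
  "share_vector K x \<longleftrightarrow> (\<forall>k\<in>{1..K}. 0 \<le> x k) \<and> (\<Sum>k=1..K. x k) = 1"

definition dominant_shares :: "nat \<Rightarrow> real \<Rightarrow> nat \<Rightarrow> real" where
  "dominant_shares K s k = (if k = 1 then s else (1 - s) / (real K - 1))"

definition sum_largest :: "nat \<Rightarrow> nat \<Rightarrow> (nat \<Rightarrow> real) \<Rightarrow> real" where
  "sum_largest K n x = sum_list (take n (rev (sort (map x [1..<Suc K]))))"

definition majorizes :: "nat \<Rightarrow> (nat \<Rightarrow> real) \<Rightarrow> (nat \<Rightarrow> real) \<Rightarrow> bool" where
  "majorizes K x' x \<longleftrightarrow>
     (\<forall>n\<le>K. sum_largest K n x \<le> sum_largest K n x') \<and> sum_largest K K x' = sum_largest K K x"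

definition affine_action ::
    "(nat \<Rightarrow> 'a \<Rightarrow> real) \<Rightarrow> (nat \<Rightarrow> real) \<Rightarrow> (nat \<Rightarrow> real) \<Rightarrow> nat \<Rightarrow> 'a \<Rightarrow> real" where
  "affine_action m \<alpha> \<gamma> k \<omega> = \<alpha> k + \<gamma> k * m k \<omega>"

definition aggregate_action ::
    "nat \<Rightarrow> (nat \<Rightarrow> 'a \<Rightarrow> real) \<Rightarrow> (nat \<Rightarrow> real) \<Rightarrow> (nat \<Rightarrow> real) \<Rightarrow> (nat \<Rightarrow> real) \<Rightarrow> 'a \<Rightarrow> real" where
  "aggregate_action K m x \<alpha> \<gamma> \<omega> = (\<Sum>k=1..K. x k * affine_action m \<alpha> \<gamma> k \<omega>)"

definition response_coefficient :: "nat \<Rightarrow> (nat \<Rightarrow> real) \<Rightarrow> (nat \<Rightarrow> real) \<Rightarrow> real" where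
  "response_coefficient K x \<gamma> = (\<Sum>k=1..K. x k * \<gamma> k)"

text \<open>
  \<open>\<mu>\<close> is the value of the posterior mean and \<open>e\<close> the conditional expectation of the aggregate
  action, which a client takes as given when choosing \<open>a\<close>.
\<close>

definition payoff ::
    "real \<Rightarrow> real \<Rightarrow> real \<Rightarrow> real \<Rightarrow> real \<Rightarrow> real \<Rightarrow> real \<Rightarrow> real \<Rightarrow> real" where
  "payoff \<psi> \<xi> c \<beta> d \<mu> e a = (a - c) * (\<psi> + \<xi> * \<mu> - \<beta> * a + d * e)"

text \<open>
  Conditional expectations are determined only up to null sets, so optimality is required almost
  surely, simultaneously against all deviations \<open>a\<close>. Coefficients are normalised outside
  \<open>{1..K}\<close> so that a pair \<open>(\<alpha>, \<gamma>)\<close> is a genuine \<open>K\<close>-vector and uniqueness is meaningful.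
\<close>

definition affine_equilibrium ::
    "'a measure \<Rightarrow> nat \<Rightarrow> (nat \<Rightarrow> 'a \<Rightarrow> real) \<Rightarrow> real \<Rightarrow> real \<Rightarrow> real \<Rightarrow> real \<Rightarrow> real \<Rightarrow>
     (nat \<Rightarrow> real) \<Rightarrow> (nat \<Rightarrow> real) \<Rightarrow> (nat \<Rightarrow> real) \<Rightarrow> bool" where
  "affine_equilibrium M K m \<psi> \<xi> c \<beta> d x \<alpha> \<gamma> \<longleftrightarrow>
     \<alpha> \<in> extensional {1..K} \<and> \<gamma> \<in> extensional {1..K} \<and>
     (\<forall>k\<in>{1..K}. AE \<omega> in M. \<forall>a.
        payoff \<psi> \<xi> c \<beta> d (m k \<omega>)
          (cond_expectation_given M borel (m k) (aggregate_action K m x \<alpha> \<gamma>) \<omega>) a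
        \<le> payoff \<psi> \<xi> c \<beta> d (m k \<omega>)
          (cond_expectation_given M borel (m k) (aggregate_action K m x \<alpha> \<gamma>) \<omega>)
          (affine_action m \<alpha> \<gamma> k \<omega>))"

end

theory Submission
  imports Defs
begin

text \<open>
  An uncorrelated residual of a Gaussian projection is independent of the signals, which gives the
  posterior mean as a common component, linear in \<open>\<theta>\<close> and the public noise, plus a multiple of the provider's own noise; hence \<open>E[m\<^sub>j | m\<^sub>k] = \<rho> m\<^sub>k\<close> for
  \<open>j \<noteq> k\<close>. The first-order condition of a client then turns into linear equations for intercepts
  and slopes, whose solution has \<open>x\<^sub>k \<gamma>\<^sub>k = \<xi> f(x\<^sub>k) / (1 - d \<rho> \<Lambda>)\<close> with
  \<open>f(u) = u / (2 \<beta> - d (1 - \<rho>) u)\<close> and \<open>\<Lambda> = \<Sum>\<^sub>k f(x\<^sub>k)\<close>. Both \<open>f\<close> and \<open>f\<^sup>2\<close> are convex on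
  \<open>[0, 1]\<close>, so by Karamata's inequality \<open>\<Lambda>\<close> and \<open>\<Sum>\<^sub>k f(x\<^sub>k)\<^sup>2\<close> increase under majorization. The
  covariance is a positive multiple of \<open>S = \<xi> \<Lambda> / (1 - d \<rho> \<Lambda>)\<close>, and the variance is a positive
  combination of \<open>S\<^sup>2\<close> and \<open>\<Sum>\<^sub>k (x\<^sub>k \<gamma>\<^sub>k)\<^sup>2\<close>.
\<close>

section \<open>Independence and Gaussian residuals\<close>

text \<open>Conditional expectations are fixed only almost surely, so an equilibrium is a family of
  almost sure identities between affine functions of \<open>m k\<close>. Such an identity determines
  its coefficients because \<open>m k\<close> has positive variance; this makes the passage to
  linear equations an equivalence and gives uniqueness. No conditional density is computed. A
  candidate for a conditional expectation is accepted once its residual is centred and independent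
  of the conditioning variable. For the posterior mean that variable is a pair of signals, and
  independence from each signal alone would not do, hence the care with joint independence and
  regrouping. The only Gaussian input is that, for two independent centred normals, the regression
  residual is independent of their sum. Majorization yields weak inequalities only. Strictness along
  the dominant-provider family needs a direct comparison, and it suffices to have it for \<Lambda>:
  the term in \<open>S^2\<close> has a positive weight in the variance and carries the strictness
  over.\<close>

text \<open>\<^const>\<open>prob_space.indep_var\<close> forces both variables to take values in the same type.\<close>

definition (in prob_space) indep_pair :: "'b measure \<Rightarrow> ('a \<Rightarrow> 'b) \<Rightarrow> 'c measure \<Rightarrow> ('a \<Rightarrow> 'c) \<Rightarrow> bool" where
  "indep_pair S X T Y \<longleftrightarrow> random_variable S X \<and> random_variable T Y \<and>
     distr M S X \<Otimes>\<^sub>M distr M T Y = distr M (S \<Otimes>\<^sub>M T) (\<lambda>\<omega>. (X \<omega>, Y \<omega>))"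

lemma (in prob_space) indep_pair_iff_indep_var: "indep_pair S X T Y \<longleftrightarrow> indep_var S X T Y"
  unfolding indep_pair_def indep_var_distribution_eq ..

lemma (in prob_space)
  assumes "indep_pair S X T Y"
  shows indep_pair_rv1: "random_variable S X" and indep_pair_rv2: "random_variable T Y"
  using assms by (auto simp: indep_pair_def)

lemma (in prob_space) indep_pair_commute:
  assumes "indep_pair S X T Y"
  shows "indep_pair T Y S X"
proof -
  note rv[measurable] = indep_pair_rv1[OF assms] indep_pair_rv2[OF assms]
  interpret X: prob_space "distr M S X" by (rule prob_space_distr) fact
  interpret Y: prob_space "distr M T Y" by (rule prob_space_distr) fact
  interpret YX: pair_prob_space "distr M T Y" "distr M S X" ..
  have "distr M T Y \<Otimes>\<^sub>M distr M S X
      = distr (distr M (S \<Otimes>\<^sub>M T) (\<lambda>\<omega>. (X \<omega>, Y \<omega>))) (T \<Otimes>\<^sub>M S) (\<lambda>(x, y). (y, x))"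
    using assms unfolding indep_pair_def
    by (subst YX.distr_pair_swap) (auto cong: distr_cong sets_pair_measure_cong)
  also have "\<dots> = distr M (T \<Otimes>\<^sub>M S) (\<lambda>\<omega>. (Y \<omega>, X \<omega>))"
    by (subst distr_distr) (auto simp: comp_def)
  finally show ?thesis
    unfolding indep_pair_def using rv by simp
qed

lemma (in prob_space) indep_pair_compose:
  assumes "indep_pair S X T Y" and [measurable]: "f \<in> measurable S S'" "g \<in> measurable T T'"
  shows "indep_pair S' (\<lambda>\<omega>. f (X \<omega>)) T' (\<lambda>\<omega>. g (Y \<omega>))"
proof -
  note rv[measurable] = indep_pair_rv1[OF assms(1)] indep_pair_rv2[OF assms(1)]
  interpret Y: prob_space "distr M T' (\<lambda>\<omega>. g (Y \<omega>))" by (rule prob_space_distr) measurable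
  have X: "distr M S' (\<lambda>\<omega>. f (X \<omega>)) = distr (distr M S X) S' f"
    and Y: "distr M T' (\<lambda>\<omega>. g (Y \<omega>)) = distr (distr M T Y) T' g"
    by (simp_all add: distr_distr comp_def)
  have "distr M S' (\<lambda>\<omega>. f (X \<omega>)) \<Otimes>\<^sub>M distr M T' (\<lambda>\<omega>. g (Y \<omega>))
      = distr (distr M S X \<Otimes>\<^sub>M distr M T Y) (S' \<Otimes>\<^sub>M T') (\<lambda>(x, y). (f x, g y))"
    unfolding X Y by (rule pair_measure_distr) (auto simp: Y[symmetric] Y.sigma_finite_measure_axioms)
  also have "distr M S X \<Otimes>\<^sub>M distr M T Y = distr M (S \<Otimes>\<^sub>M T) (\<lambda>\<omega>. (X \<omega>, Y \<omega>))"
    using assms(1) by (simp add: indep_pair_def)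
  also have "distr \<dots> (S' \<Otimes>\<^sub>M T') (\<lambda>(x, y). (f x, g y)) = distr M (S' \<Otimes>\<^sub>M T') (\<lambda>\<omega>. (f (X \<omega>), g (Y \<omega>)))"
    by (subst distr_distr) (auto simp: comp_def)
  finally show ?thesis
    unfolding indep_pair_def by simp
qed

text \<open>Both hypotheses together say that the law of the triple is the product of the three
  laws, and that product may be bracketed either way. This is how independence from one variable is
  upgraded to independence from a pair.\<close>

lemma (in prob_space) indep_pair_Pair_assoc:
  assumes XY: "indep_pair S X T Y"
    and XYZ: "indep_pair (S \<Otimes>\<^sub>M T) (\<lambda>\<omega>. (X \<omega>, Y \<omega>)) U Z"
  shows "indep_pair S X (T \<Otimes>\<^sub>M U) (\<lambda>\<omega>. (Y \<omega>, Z \<omega>))"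
proof -
  note [measurable] = indep_pair_rv1[OF XY] indep_pair_rv2[OF XY] indep_pair_rv2[OF XYZ]
  have YZ: "indep_pair T Y U Z"
    using indep_pair_compose[OF XYZ measurable_snd measurable_ident] by simp
  define DX DY DZ where "DX = distr M S X" and "DY = distr M T Y" and "DZ = distr M U Z"
  have [measurable_cong]: "sets DX = sets S" "sets DY = sets T" "sets DZ = sets U"
    by (simp_all add: DX_def DY_def DZ_def)
  interpret X: prob_space DX unfolding DX_def by (rule prob_space_distr) simp
  interpret Y: prob_space DY unfolding DY_def by (rule prob_space_distr) simp
  interpret Z: prob_space DZ unfolding DZ_def by (rule prob_space_distr) simp
  interpret YZ: pair_prob_space DY DZ ..
  interpret XY: pair_prob_space DX DY ..
  have eqXY: "distr M (S \<Otimes>\<^sub>M T) (\<lambda>\<omega>. (X \<omega>, Y \<omega>)) = DX \<Otimes>\<^sub>M DY"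
    using XY unfolding indep_pair_def DX_def DY_def by simp
  have eqYZ: "distr M (T \<Otimes>\<^sub>M U) (\<lambda>\<omega>. (Y \<omega>, Z \<omega>)) = DY \<Otimes>\<^sub>M DZ"
    using YZ unfolding indep_pair_def DY_def DZ_def by simp
  have eqXYZ: "distr M ((S \<Otimes>\<^sub>M T) \<Otimes>\<^sub>M U) (\<lambda>\<omega>. ((X \<omega>, Y \<omega>), Z \<omega>)) = (DX \<Otimes>\<^sub>M DY) \<Otimes>\<^sub>M DZ"
    using XYZ unfolding indep_pair_def eqXY DZ_def by simp
  have "DX \<Otimes>\<^sub>M (DY \<Otimes>\<^sub>M DZ) = distr M (S \<Otimes>\<^sub>M (T \<Otimes>\<^sub>M U)) (\<lambda>\<omega>. (X \<omega>, Y \<omega>, Z \<omega>))"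
  proof (rule measure_eqI)
    show "sets (DX \<Otimes>\<^sub>M (DY \<Otimes>\<^sub>M DZ)) = sets (distr M (S \<Otimes>\<^sub>M (T \<Otimes>\<^sub>M U)) (\<lambda>\<omega>. (X \<omega>, Y \<omega>, Z \<omega>)))"
      by (simp cong: sets_pair_measure_cong add: DX_def DY_def DZ_def)
    fix A assume "A \<in> sets (DX \<Otimes>\<^sub>M (DY \<Otimes>\<^sub>M DZ))"
    also have "sets (DX \<Otimes>\<^sub>M (DY \<Otimes>\<^sub>M DZ)) = sets (S \<Otimes>\<^sub>M (T \<Otimes>\<^sub>M U))"
      by (simp cong: sets_pair_measure_cong add: DX_def DY_def DZ_def)
    finally have [measurable]: "A \<in> sets (S \<Otimes>\<^sub>M (T \<Otimes>\<^sub>M U))" .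
    \<comment> \<open>Both bracketings are unfolded to the same iterated integral over
      \<open>DX\<close>, \<open>DY\<close>, \<open>DZ\<close>; the right-hand one is then the law of
      the triple by \<open>eqXYZ\<close>.\<close>
    have "emeasure (DX \<Otimes>\<^sub>M (DY \<Otimes>\<^sub>M DZ)) A = (\<integral>\<^sup>+p. indicator A p \<partial>(DX \<Otimes>\<^sub>M (DY \<Otimes>\<^sub>M DZ)))"
      by simp
    also have "\<dots> = (\<integral>\<^sup>+x. \<integral>\<^sup>+y. \<integral>\<^sup>+z. indicator A (x, y, z) \<partial>DZ \<partial>DY \<partial>DX)"
      by (simp add: YZ.nn_integral_fst[symmetric] del: nn_integral_indicator)
         (auto intro!: nn_integral_cong Z.nn_integral_fst[symmetric] measurable_compose[OF measurable_Pair1'])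
    also have "\<dots> = (\<integral>\<^sup>+p. indicator A (fst (fst p), snd (fst p), snd p) \<partial>((DX \<Otimes>\<^sub>M DY) \<Otimes>\<^sub>M DZ))"
      by (simp add: Y.nn_integral_fst[symmetric] Z.nn_integral_fst[symmetric] del: nn_integral_indicator)
    also have "\<dots> = (\<integral>\<^sup>+\<omega>. indicator A (X \<omega>, Y \<omega>, Z \<omega>) \<partial>M)"
      unfolding eqXYZ[symmetric] by (subst nn_integral_distr) auto
    also have "\<dots> = (\<integral>\<^sup>+p. indicator A p \<partial>distr M (S \<Otimes>\<^sub>M (T \<Otimes>\<^sub>M U)) (\<lambda>\<omega>. (X \<omega>, Y \<omega>, Z \<omega>)))"
      by (subst nn_integral_distr) auto
    also have "\<dots> = emeasure (distr M (S \<Otimes>\<^sub>M (T \<Otimes>\<^sub>M U)) (\<lambda>\<omega>. (X \<omega>, Y \<omega>, Z \<omega>))) A"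
      by (subst nn_integral_indicator) auto
    finally show "emeasure (DX \<Otimes>\<^sub>M (DY \<Otimes>\<^sub>M DZ)) A = \<dots>" .
  qed
  then show ?thesis
    unfolding indep_pair_def eqYZ DX_def[symmetric] by simp
qed

section \<open>The Gaussian change of variables\<close>

text \<open>The joint density of two independent normals in the coordinates
  \<open>u = x + y\<close>, \<open>r = x - k * u\<close>. The value of \<open>k\<close> is the
  regression coefficient of the first variable on the sum, the one for which the mixed term
  \<open>u * r\<close> in the exponent cancels, so that the density factors.\<close>

lemma normal_density_mult_shear:
  fixes \<sigma> \<tau> u r :: real
  assumes "0 < \<sigma>" "0 < \<tau>"
  defines "s \<equiv> sqrt (\<sigma>\<^sup>2 + \<tau>\<^sup>2)" and "k \<equiv> \<sigma>\<^sup>2 / (\<sigma>\<^sup>2 + \<tau>\<^sup>2)"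
  shows "normal_density 0 \<sigma> (r + k * u) * normal_density 0 \<tau> (u - (r + k * u))
    = normal_density 0 s u * normal_density 0 (\<sigma> * \<tau> / s) r"
proof -
  have pos: "0 < \<sigma>\<^sup>2 + \<tau>\<^sup>2" using assms by (simp add: add_pos_pos)
  have s2: "s\<^sup>2 = \<sigma>\<^sup>2 + \<tau>\<^sup>2" and s: "0 < s" using pos by (simp_all add: s_def)
  have root: "sqrt (2 * pi * a\<^sup>2) = sqrt (2 * pi) * a" if "0 < a" for a :: real
    using that by (simp add: real_sqrt_mult)
  \<comment> \<open>Writing the two variances as fractions \<open>k\<close> and \<open>1 - k\<close>
    of \<open>s^2\<close> leaves a polynomial identity for the exponents.\<close>
  have k: "\<sigma>\<^sup>2 = k * s\<^sup>2" "\<tau>\<^sup>2 = (1 - k) * s\<^sup>2"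
    using pos unfolding s2 by (simp_all add: k_def left_diff_distrib)
  have k01: "k \<noteq> 0" "1 - k \<noteq> 0" "s\<^sup>2 \<noteq> 0"
    using s pos assms(1,2) mult_zero_left[of "s\<^sup>2"] unfolding k(2)[symmetric]
    by (auto simp: k_def field_simps)
  have alg: "(r + k * u)\<^sup>2 / (2 * (k * w)) + (u - (r + k * u))\<^sup>2 / (2 * (l * w))
      = u\<^sup>2 / (2 * w) + r\<^sup>2 / (2 * (k * l * w))" if "l = 1 - k" "k \<noteq> 0" "l \<noteq> 0" "w \<noteq> 0" for l w
  proof -
    have "(r + k * u)\<^sup>2 * l + (u - (r + k * u))\<^sup>2 * k = u\<^sup>2 * (k * l) + r\<^sup>2"
      unfolding \<open>l = 1 - k\<close> by algebra
    then have "((r + k * u)\<^sup>2 * l + (u - (r + k * u))\<^sup>2 * k) / (2 * k * l * w)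
        = (u\<^sup>2 * (k * l) + r\<^sup>2) / (2 * k * l * w)"
      by simp
    then show ?thesis
      using that(2-) by (simp add: add_divide_distrib mult.commute mult.left_commute)
  qed
  have "(\<sigma> * \<tau> / s)\<^sup>2 = k * (1 - k) * s\<^sup>2"
    using k01(3) unfolding power_divide power_mult_distrib k by (simp add: power2_eq_square)
  then have "(r + k * u)\<^sup>2 / (2 * \<sigma>\<^sup>2) + (u - (r + k * u))\<^sup>2 / (2 * \<tau>\<^sup>2)
      = u\<^sup>2 / (2 * s\<^sup>2) + r\<^sup>2 / (2 * (\<sigma> * \<tau> / s)\<^sup>2)"
    unfolding k by (simp only: alg[OF refl k01])
  then have "exp (- (r + k * u)\<^sup>2 / (2 * \<sigma>\<^sup>2)) * exp (- (u - (r + k * u))\<^sup>2 / (2 * \<tau>\<^sup>2))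
      = exp (- u\<^sup>2 / (2 * s\<^sup>2)) * exp (- r\<^sup>2 / (2 * (\<sigma> * \<tau> / s)\<^sup>2))"
    by (simp add: exp_add[symmetric])
  moreover have "1 / sqrt (2 * pi * \<sigma>\<^sup>2) * (1 / sqrt (2 * pi * \<tau>\<^sup>2))
      = 1 / sqrt (2 * pi * s\<^sup>2) * (1 / sqrt (2 * pi * (\<sigma> * \<tau> / s)\<^sup>2))"
    using s assms(1,2) by (simp add: root)
  moreover have "(a * e) * (b * f) = (a * b) * (e * f)" for a b e f :: real
    by simp
  ultimately show ?thesis
    unfolding normal_density_def diff_0_right by (simp only:)
qed

text \<open>Applied to \<theta> and the public noise, to the resulting residual and a private noise,
  and to \<open>common\<close> and \<open>idio k\<close>. The law of the residual is part of the
  conclusion because the second application takes the residual of the first as input.\<close>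

lemma (in prob_space) gaussian_sum_residual:
  fixes X Y :: "'a \<Rightarrow> real"
  assumes XY: "indep_var borel X borel Y" and pos: "0 < \<sigma>" "0 < \<tau>"
    and X: "distributed M lborel X (normal_density 0 \<sigma>)"
    and Y: "distributed M lborel Y (normal_density 0 \<tau>)"
  defines "s \<equiv> sqrt (\<sigma>\<^sup>2 + \<tau>\<^sup>2)" and "k \<equiv> \<sigma>\<^sup>2 / (\<sigma>\<^sup>2 + \<tau>\<^sup>2)"
  shows "distributed M lborel (\<lambda>\<omega>. X \<omega> - k * (X \<omega> + Y \<omega>)) (normal_density 0 (\<sigma> * \<tau> / s))"
    and "indep_var borel (\<lambda>\<omega>. X \<omega> + Y \<omega>) borel (\<lambda>\<omega>. X \<omega> - k * (X \<omega> + Y \<omega>))"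
proof -
  have p2: "0 < \<sigma>\<^sup>2 + \<tau>\<^sup>2" using pos by (simp add: add_pos_pos)
  have s: "0 < s" and s2: "s\<^sup>2 = \<sigma>\<^sup>2 + \<tau>\<^sup>2" using p2 by (simp_all add: s_def)
  have t: "0 < \<sigma> * \<tau> / s" using s pos by simp
  have rv[measurable]: "X \<in> borel_measurable M" "Y \<in> borel_measurable M"
    using XY by (auto dest: indep_var_rv1 indep_var_rv2)
  define R where "R \<omega> = X \<omega> - k * (X \<omega> + Y \<omega>)" for \<omega>
  have [measurable]: "R \<in> borel_measurable M" unfolding R_def by measurable
  have sum: "distributed M lborel (\<lambda>\<omega>. X \<omega> + Y \<omega>) (normal_density 0 s)"
    using add_indep_normal[OF XY pos X Y] by (simp add: s_def)
  have joint: "distributed M (lborel \<Otimes>\<^sub>M lborel) (\<lambda>\<omega>. (X \<omega>, Y \<omega>))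
      (\<lambda>(x, y). ennreal (normal_density 0 \<sigma> x) * ennreal (normal_density 0 \<tau> y))"
    using XY by (intro distributed_joint_indep X Y) (auto simp: sigma_finite_lborel indep_var_distribution_eq
        cong: distr_cong)
  \<comment> \<open>The map \<open>(x, y) \<mapsto> (x + y, x - k (x + y))\<close> is a composition of two shears, each of which
    is a translation in one coordinate and so preserves Lebesgue measure.\<close>
  have UR: "distr M (lborel \<Otimes>\<^sub>M lborel) (\<lambda>\<omega>. (X \<omega> + Y \<omega>, R \<omega>))
     = density lborel (normal_density 0 s) \<Otimes>\<^sub>M density lborel (normal_density 0 (\<sigma> * \<tau> / s))"
    (is "?L = ?D")
  proof (rule measure_eqI)
    show "sets ?L = sets ?D" by (simp cong: sets_pair_measure_cong)
    fix A assume "A \<in> sets ?L"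
    then have [measurable]: "A \<in> sets (borel \<Otimes>\<^sub>M borel)"
      by (simp cong: sets_pair_measure_cong)
    let ?f = "normal_density 0 \<sigma>" and ?g = "normal_density 0 \<tau>"
    have "emeasure ?L A = (\<integral>\<^sup>+p. indicator A p \<partial>?L)"
      by (subst nn_integral_indicator) auto
    also have "\<dots> = (\<integral>\<^sup>+\<omega>. indicator A (X \<omega> + Y \<omega>, X \<omega> - k * (X \<omega> + Y \<omega>)) \<partial>M)"
      by (subst nn_integral_distr) (auto simp: R_def)
    also have "\<dots> = (\<integral>\<^sup>+p. (case p of (x, y) \<Rightarrow> ennreal (?f x) * ennreal (?g y))
        * indicator A (fst p + snd p, fst p - k * (fst p + snd p)) \<partial>(lborel \<Otimes>\<^sub>M lborel))"
      by (subst distributed_nn_integral[OF joint]) auto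
    also have "\<dots> = (\<integral>\<^sup>+x. \<integral>\<^sup>+y. ennreal (?f x * ?g y) * indicator A (x + y, x - k * (x + y)) \<partial>lborel \<partial>lborel)"
      by (subst lborel.nn_integral_fst[symmetric]) (auto simp: ennreal_mult)
    also have "\<dots> = (\<integral>\<^sup>+x. \<integral>\<^sup>+u. ennreal (?f x * ?g (u - x)) * indicator A (u, x - k * u) \<partial>lborel \<partial>lborel)"
    proof (rule nn_integral_cong)
      fix x :: real
      show "(\<integral>\<^sup>+y. ennreal (?f x * ?g y) * indicator A (x + y, x - k * (x + y)) \<partial>lborel)
         = (\<integral>\<^sup>+u. ennreal (?f x * ?g (u - x)) * indicator A (u, x - k * u) \<partial>lborel)"
        by (subst nn_integral_real_affine[where c=1 and t="- x"]) (auto simp: algebra_simps)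
    qed
    also have "\<dots> = (\<integral>\<^sup>+u. \<integral>\<^sup>+x. ennreal (?f x * ?g (u - x)) * indicator A (u, x - k * u) \<partial>lborel \<partial>lborel)"
      by (rule lborel_pair.Fubini') measurable
    also have "\<dots> = (\<integral>\<^sup>+u. \<integral>\<^sup>+r. ennreal (?f (r + k * u) * ?g (u - (r + k * u))) * indicator A (u, r) \<partial>lborel \<partial>lborel)"
    proof (rule nn_integral_cong)
      fix u :: real
      show "(\<integral>\<^sup>+x. ennreal (?f x * ?g (u - x)) * indicator A (u, x - k * u) \<partial>lborel)
         = (\<integral>\<^sup>+r. ennreal (?f (r + k * u) * ?g (u - (r + k * u))) * indicator A (u, r) \<partial>lborel)"
        by (subst nn_integral_real_affine[where c=1 and t="k * u"]) (auto simp: add.commute)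
    qed
    also have "\<dots> = (\<integral>\<^sup>+u. \<integral>\<^sup>+r. ennreal (normal_density 0 s u * normal_density 0 (\<sigma> * \<tau> / s) r)
        * indicator A (u, r) \<partial>lborel \<partial>lborel)"
      unfolding s_def k_def normal_density_mult_shear[OF pos] ..
    also have "\<dots> = (\<integral>\<^sup>+p. (case p of (u, r) \<Rightarrow> ennreal (normal_density 0 s u)
        * ennreal (normal_density 0 (\<sigma> * \<tau> / s) r)) * indicator A p \<partial>(lborel \<Otimes>\<^sub>M lborel))"
      by (subst lborel.nn_integral_fst[symmetric]) (auto simp: ennreal_mult)
    also have "\<dots> = emeasure (density (lborel \<Otimes>\<^sub>M lborel) (\<lambda>(u, r). ennreal (normal_density 0 s u)
        * ennreal (normal_density 0 (\<sigma> * \<tau> / s) r))) A"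
      by (subst emeasure_density) auto
    also have "\<dots> = emeasure ?D A"
      using prob_space_normal_density[OF t, of 0]
      by (subst pair_measure_density)
         (auto simp: sigma_finite_lborel prob_space_def finite_measure_def)
    finally show "emeasure ?L A = emeasure ?D A" .
  qed
  interpret S: prob_space "density lborel (normal_density 0 s)"
    by (rule prob_space_normal_density[OF s])
  interpret T: prob_space "density lborel (normal_density 0 (\<sigma> * \<tau> / s))"
    by (rule prob_space_normal_density[OF t])
  \<comment> \<open>The marginal law of \<open>R\<close> comes from the sets
    \<open>UNIV \<times> B\<close>, since the first factor has total mass 1.\<close>
  have R: "distr M lborel R = density lborel (normal_density 0 (\<sigma> * \<tau> / s))"
  proof (rule measure_eqI)
    fix B assume "B \<in> sets (distr M lborel R)"
    then have [measurable]: "B \<in> sets borel" by simp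
    have "emeasure (distr M lborel R) B
        = emeasure (distr M (lborel \<Otimes>\<^sub>M lborel) (\<lambda>\<omega>. (X \<omega> + Y \<omega>, R \<omega>))) (UNIV \<times> B)"
      by (subst (1 2) emeasure_distr) (auto intro!: arg_cong[where f="emeasure M"])
    also have "\<dots> = emeasure (density lborel (normal_density 0 (\<sigma> * \<tau> / s))) B"
      unfolding UR using S.emeasure_space_1 by (subst T.emeasure_pair_measure_Times) auto
    finally show "emeasure (distr M lborel R) B = \<dots>" .
  qed simp
  then show "distributed M lborel (\<lambda>\<omega>. X \<omega> - k * (X \<omega> + Y \<omega>)) (normal_density 0 (\<sigma> * \<tau> / s))"
    unfolding distributed_def R_def[abs_def, symmetric] by auto
  have "distr M borel R = density lborel (normal_density 0 (\<sigma> * \<tau> / s))"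
    unfolding R[symmetric] by (rule distr_cong) auto
  moreover have "distr M borel (\<lambda>\<omega>. X \<omega> + Y \<omega>) = density lborel (normal_density 0 s)"
    unfolding distributed_distr_eq_density[OF sum, symmetric] by (rule distr_cong) auto
  moreover have "distr M (borel \<Otimes>\<^sub>M borel) (\<lambda>\<omega>. (X \<omega> + Y \<omega>, R \<omega>))
      = density lborel (normal_density 0 s) \<Otimes>\<^sub>M density lborel (normal_density 0 (\<sigma> * \<tau> / s))"
    unfolding UR[symmetric] by (rule distr_cong) (auto cong: sets_pair_measure_cong)
  moreover have "random_variable borel (\<lambda>\<omega>. X \<omega> + Y \<omega>)" "random_variable borel R" by measurable
  ultimately show "indep_var borel (\<lambda>\<omega>. X \<omega> + Y \<omega>) borel (\<lambda>\<omega>. X \<omega> - k * (X \<omega> + Y \<omega>))"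
    unfolding indep_var_distribution_eq R_def[abs_def, symmetric] by (simp only: simp_thms)
qed

section \<open>Conditional expectations from orthogonality to events\<close>

text \<open>Every event of the generated sigma-algebra is a preimage of some \<open>B\<close> under
  \<open>U\<close>, so orthogonality of the residual to all indicators of such \<open>B\<close> is
  the defining property of the conditional expectation.\<close>

lemma (in prob_space) cond_expectation_given_eqI:
  assumes U[measurable]: "U \<in> measurable M N" and X: "integrable M X"
    and g[measurable]: "g \<in> borel_measurable N" and gU: "integrable M (\<lambda>\<omega>. g (U \<omega>))"
    and ortho: "\<And>B. B \<in> sets N \<Longrightarrow> (\<integral>\<omega>. indicator B (U \<omega>) * (X \<omega> - g (U \<omega>)) \<partial>M) = 0"
  shows "AE \<omega> in M. cond_expectation_given M N U X \<omega> = g (U \<omega>)"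
proof -
  let ?F = "vimage_algebra (space M) U N"
  have UN: "U \<in> space M \<rightarrow> space N" using measurable_space[OF U] by auto
  have sub: "subalgebra M ?F"
    unfolding subalgebra_def using measurable_sets[OF U] by (auto simp: sets_vimage_algebra2[OF UN])
  have "finite_measure_subalgebra M ?F"
    using sub by (simp add: finite_measure_subalgebra_def finite_measure_subalgebra_axioms_def finite_measure_axioms)
  then interpret F: sigma_finite_subalgebra M ?F
    by (rule finite_measure_subalgebra_is_sigma_finite)
  show ?thesis
    unfolding cond_expectation_given_def
  proof (rule F.real_cond_exp_charact[OF _ X gU])
    show "(\<lambda>\<omega>. g (U \<omega>)) \<in> borel_measurable ?F"
      using measurable_compose[OF measurable_vimage_algebra1[OF UN] g] .
    fix A assume "A \<in> sets ?F"
    then obtain B where B: "B \<in> sets N" "A = U -` B \<inter> space M"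
      by (auto simp: sets_vimage_algebra2[OF UN])
    then have A: "A \<in> sets M" by auto
    have "0 = (\<integral>\<omega>. indicator B (U \<omega>) * (X \<omega> - g (U \<omega>)) \<partial>M)" using ortho[OF B(1)] ..
    also have "\<dots> = (\<integral>\<omega>. indicator A \<omega> *\<^sub>R X \<omega> - indicator A \<omega> *\<^sub>R g (U \<omega>) \<partial>M)"
      by (rule Bochner_Integration.integral_cong) (auto simp: B indicator_def)
    also have "\<dots> = (\<integral>\<omega>\<in>A. X \<omega> \<partial>M) - (\<integral>\<omega>\<in>A. g (U \<omega>) \<partial>M)"
      unfolding set_lebesgue_integral_def
      using integrable_mult_indicator[OF A X] integrable_mult_indicator[OF A gU]
      by (rule Bochner_Integration.integral_diff)
    finally show "(\<integral>\<omega>\<in>A. X \<omega> \<partial>M) = (\<integral>\<omega>\<in>A. g (U \<omega>) \<partial>M)" by simp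
  qed
qed

text \<open>Discharges the orthogonality hypothesis of \<open>cond_expectation_given_eqI\<close>: by
  independence the expectation factors, and the second factor is zero.\<close>

lemma (in prob_space) indep_pair_integral_indicator_mult:
  fixes V :: "'a \<Rightarrow> real"
  assumes "indep_pair N U borel V" "integrable M V" "expectation V = 0" "B \<in> sets N"
  shows "(\<integral>\<omega>. indicator B (U \<omega>) * V \<omega> \<partial>M) = 0"
proof -
  have [measurable]: "U \<in> measurable M N" using assms(1) by (rule indep_pair_rv1)
  have [measurable]: "B \<in> sets N" by fact
  have "indep_var borel (\<lambda>\<omega>. indicator B (U \<omega>) :: real) borel V"
    unfolding indep_pair_iff_indep_var[symmetric]
    by (rule indep_pair_compose[OF assms(1), of "indicator B :: _ \<Rightarrow> real" borel "\<lambda>x. x" borel]) auto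
  then have "(\<integral>\<omega>. indicator B (U \<omega>) * V \<omega> \<partial>M) = (\<integral>\<omega>. indicator B (U \<omega>) \<partial>M) * expectation V"
    by (rule indep_var_lebesgue_integral) (auto intro!: integrable_const_bound[where B=1] assms(2))
  then show ?thesis
    unfolding assms(3) by simp
qed

section \<open>The posterior means\<close>

lemma (in prob_space) normal_distributed_moments:
  assumes \<sigma>: "0 < \<sigma>" and D: "distributed M lborel X (normal_density 0 \<sigma>)"
  shows "integrable M X" "expectation X = 0"
    "integrable M (\<lambda>\<omega>. X \<omega> * X \<omega>)" "expectation (\<lambda>\<omega>. X \<omega> * X \<omega>) = \<sigma>\<^sup>2"
proof -
  show "integrable M X"
    using distributed_integrable[OF D, of "\<lambda>x. x"] integrable_normal_moment[OF \<sigma>, of 0 1] by simp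
  show E: "expectation X = 0"
    by (rule normal_distributed_expectation[OF \<sigma> D])
  show "integrable M (\<lambda>\<omega>. X \<omega> * X \<omega>)"
    using distributed_integrable[OF D, of "\<lambda>x. x * x"] integrable_normal_moment[OF \<sigma>, of 0 2]
    by (simp add: power2_eq_square)
  show "expectation (\<lambda>\<omega>. X \<omega> * X \<omega>) = \<sigma>\<^sup>2"
    using normal_distributed_variance[OF \<sigma> D] by (simp add: E power2_eq_square)
qed

lemma (in prob_space) indep_vars_imp_indep_var:
  assumes "indep_vars (\<lambda>_. borel) X I" "i \<in> I" "j \<in> I" "i \<noteq> j"
  shows "indep_var borel (X i) borel (X j)"
proof -
  have "indep_pair (PiM {i} (\<lambda>_. borel)) (\<lambda>\<omega>. restrict (\<lambda>i. X i \<omega>) {i})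
      (PiM {j} (\<lambda>_. borel)) (\<lambda>\<omega>. restrict (\<lambda>i. X i \<omega>) {j})"
    unfolding indep_pair_iff_indep_var using assms by (intro indep_var_restrict[OF assms(1)]) auto
  from indep_pair_compose[OF this, of "\<lambda>f. f i" borel "\<lambda>f. f j" borel]
  show ?thesis by (simp add: indep_pair_iff_indep_var)
qed

locale signal_model = prob_space M for M :: "'a measure" +
  fixes K :: nat and \<tau>\<^sub>\<theta> \<tau>\<^sub>g \<tau>\<^sub>y :: real and \<theta> :: "'a \<Rightarrow> real" and \<eta> :: "nat \<Rightarrow> 'a \<Rightarrow> real"
  assumes pos: "0 < \<tau>\<^sub>\<theta>" "0 < \<tau>\<^sub>g" "0 < \<tau>\<^sub>y"
    and signals: "signal_structure M K \<tau>\<^sub>\<theta> \<tau>\<^sub>g \<tau>\<^sub>y \<theta> \<eta>"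
begin

definition T :: real where "T = \<tau>\<^sub>\<theta> + \<tau>\<^sub>g + \<tau>\<^sub>y"

text \<open>Up to constants and null sets, the state, the posterior means and the aggregate action
  are all of this form, so a single second-moment formula gives every covariance and
  variance.\<close>

definition lin :: "real \<Rightarrow> real \<Rightarrow> (nat \<Rightarrow> real) \<Rightarrow> 'a \<Rightarrow> real" where
  "lin p q r \<omega> = p * \<theta> \<omega> + q * \<eta> 0 \<omega> + (\<Sum>k=1..K. r k * \<eta> k \<omega>)"

abbreviation m :: "nat \<Rightarrow> 'a \<Rightarrow> real" where "m \<equiv> posterior_mean M \<theta> \<eta>"

abbreviation \<rho> :: real where "\<rho> \<equiv> posterior_corr \<tau>\<^sub>\<theta> \<tau>\<^sub>g \<tau>\<^sub>y"

text \<open>The Bayes estimate weights the public signal by \<open>\<tau>\<^sub>g / T\<close> and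
  the private one by \<open>\<tau>\<^sub>y / T\<close>. Its terms in \<theta> and
  \<open>\<eta> 0\<close>, which are the same for all providers, are collected here; the remaining
  term is \<open>idio k\<close>.\<close>

definition common :: "'a \<Rightarrow> real" where
  "common \<omega> = ((\<tau>\<^sub>g + \<tau>\<^sub>y) * \<theta> \<omega> + \<tau>\<^sub>g * \<eta> 0 \<omega>) / T"

definition idio :: "nat \<Rightarrow> 'a \<Rightarrow> real" where
  "idio k \<omega> = \<tau>\<^sub>y / T * \<eta> k \<omega>"

text \<open>The variance of \<open>common\<close>: squared coefficients of \<theta> and
  \<open>\<eta> 0\<close>, each divided by its precision. It equals \<rho> times the variance of a
  posterior mean, the factor in the common component.\<close>

definition var_common :: real where
  "var_common = ((\<tau>\<^sub>g + \<tau>\<^sub>y)\<^sup>2 / \<tau>\<^sub>\<theta> + \<tau>\<^sub>g) / T\<^sup>2"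

definition var_idio :: real where
  "var_idio = \<tau>\<^sub>y / T\<^sup>2"

lemma T_pos: "0 < T" using pos by (simp add: T_def)

lemma var_common_pos: "0 < var_common"
  using pos T_pos by (simp add: var_common_def add_pos_pos)

lemma var_idio_pos: "0 < var_idio"
  using pos T_pos by (simp add: var_idio_def)

text \<open>Identifies \<rho> as the common share of the variance of a posterior mean. This gives
  its bounds and shows that it is the regression coefficient of \<open>common\<close> on
  \<open>common + idio k\<close>.\<close>

lemma rho_eq: "\<rho> = var_common / (var_common + var_idio)"
proof -
  have "var_common + var_idio = (\<tau>\<^sub>g + \<tau>\<^sub>y) * (\<tau>\<^sub>g + \<tau>\<^sub>y + \<tau>\<^sub>\<theta>) / (\<tau>\<^sub>\<theta> * T\<^sup>2)"
    using pos T_pos unfolding var_common_def var_idio_def add_divide_distrib[symmetric]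
    by (simp add: divide_simps) (simp add: algebra_simps power2_eq_square)
  also have "\<dots> = (\<tau>\<^sub>g + \<tau>\<^sub>y) / (\<tau>\<^sub>\<theta> * T)"
    using pos T_pos by (simp add: T_def[symmetric] add.commute add.left_commute power2_eq_square)
       (simp add: T_def add.commute add.left_commute)
  finally have s: "var_common + var_idio = (\<tau>\<^sub>g + \<tau>\<^sub>y) / (\<tau>\<^sub>\<theta> * T)" .
  have "\<rho> = 1 - (\<tau>\<^sub>y / T\<^sup>2) / ((\<tau>\<^sub>g + \<tau>\<^sub>y) / (\<tau>\<^sub>\<theta> * T))"
    using pos T_pos unfolding posterior_corr_def T_def[symmetric] by (simp add: power2_eq_square mult.commute)
  then have "\<rho> = 1 - var_idio / (var_common + var_idio)"
    unfolding s[symmetric] var_idio_def[symmetric] .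
  then show ?thesis
    using var_common_pos var_idio_pos by (simp add: field_simps)
qed

lemma rho_bounds: "0 < \<rho>" "\<rho> < 1"
  using var_common_pos var_idio_pos by (simp_all add: rho_eq)

section \<open>Second moments of linear combinations of state and noises\<close>

definition source :: "nat option \<Rightarrow> 'a \<Rightarrow> real" where
  "source i = (case i of None \<Rightarrow> \<theta> | Some k \<Rightarrow> \<eta> k)"

lemma indep_sources: "indep_vars (\<lambda>_. borel) source (insert None (Some ` {0..K}))"
  using signals by (simp add: signal_structure_def source_def[abs_def])

lemma distributed_sources:
  "distributed M lborel \<theta> (normal_density 0 (1 / sqrt \<tau>\<^sub>\<theta>))"
  "distributed M lborel (\<eta> 0) (normal_density 0 (1 / sqrt \<tau>\<^sub>g))"
  "k \<in> {1..K} \<Longrightarrow> distributed M lborel (\<eta> k) (normal_density 0 (1 / sqrt \<tau>\<^sub>y))"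
  using signals by (auto simp: signal_structure_def)

lemma source_moments:
  assumes "i \<in> insert None (Some ` {0..K})" "j \<in> insert None (Some ` {0..K})"
  shows "integrable M (source i)" "expectation (source i) = 0"
    "integrable M (\<lambda>\<omega>. source i \<omega> * source j \<omega>)"
    "i \<noteq> j \<Longrightarrow> expectation (\<lambda>\<omega>. source i \<omega> * source j \<omega>) = 0"
proof -
  have *: "integrable M (source i)" "expectation (source i) = 0" "integrable M (\<lambda>\<omega>. source i \<omega> * source i \<omega>)"
    if "i \<in> insert None (Some ` {0..K})" for i
  proof -
    obtain \<sigma> where "0 < \<sigma>" "distributed M lborel (source i) (normal_density 0 \<sigma>)"
    proof (cases i)
      case None
      then show ?thesis using that[of "1 / sqrt \<tau>\<^sub>\<theta>"] pos distributed_sources(1) by (simp add: source_def)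
    next
      case (Some k)
      show ?thesis
      proof (cases "k = 0")
        case True
        then show ?thesis using that[of "1 / sqrt \<tau>\<^sub>g"] pos Some distributed_sources(2) by (simp add: source_def)
      next
        case False
        then have "k \<in> {1..K}" using Some \<open>i \<in> _\<close> by auto
        then show ?thesis
          using that[of "1 / sqrt \<tau>\<^sub>y"] pos Some distributed_sources(3)[of k] by (simp add: source_def)
      qed
    qed
    then show "integrable M (source i)" "expectation (source i) = 0"
        "integrable M (\<lambda>\<omega>. source i \<omega> * source i \<omega>)"
      using normal_distributed_moments by auto
  qed
  show "integrable M (source i)" "expectation (source i) = 0" using * assms by auto
  have ind: "indep_var borel (source i) borel (source j)" if "i \<noteq> j"
    using indep_vars_imp_indep_var[OF indep_sources] assms that by blast
  show "integrable M (\<lambda>\<omega>. source i \<omega> * source j \<omega>)"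
    using *[OF assms(1)] *[OF assms(2)] indep_var_integrable[OF ind] by (cases "i = j") auto
  show "expectation (\<lambda>\<omega>. source i \<omega> * source j \<omega>) = 0" if "i \<noteq> j"
    using *[OF assms(1)] *[OF assms(2)] indep_var_lebesgue_integral[OF ind[OF that]] by auto
qed

text \<open>Moves the coefficients onto the index set of the joint independence assumption. The
  index \<open>Some 0\<close> belongs to the public noise and therefore carries \<open>q\<close>,
  not \<open>r 0\<close>.\<close>

lemma lin_eq_sum:
  "lin p q r \<omega> = (\<Sum>i\<in>insert None (Some ` {0..K}).
     (case i of None \<Rightarrow> p | Some k \<Rightarrow> if k = 0 then q else r k) * source i \<omega>)"
proof -
  have "(\<Sum>i\<in>Some ` {0..K}. (case i of None \<Rightarrow> p | Some k \<Rightarrow> if k = 0 then q else r k) * source i \<omega>)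
      = (\<Sum>k=0..K. (if k = 0 then q else r k) * \<eta> k \<omega>)"
    by (subst sum.reindex) (auto simp: source_def)
  also have "\<dots> = q * \<eta> 0 \<omega> + (\<Sum>k=1..K. r k * \<eta> k \<omega>)"
    by (subst sum.atLeast_Suc_atMost) (auto intro!: sum.cong)
  finally show ?thesis
    by (subst sum.insert) (auto simp: lin_def source_def)
qed

lemma integrable_lin [simp]: "integrable M (lin p q r)"
  unfolding lin_eq_sum[abs_def]
  by (intro Bochner_Integration.integrable_sum integrable_mult_right source_moments) auto

lemma expectation_lin [simp]: "expectation (lin p q r) = 0"
proof -
  define I where "I = insert None (Some ` {0..K})"
  show ?thesis
    unfolding lin_eq_sum[abs_def] I_def[symmetric]
    by (subst Bochner_Integration.integral_sum)
       (simp_all add: source_moments[folded I_def])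
qed

text \<open>Expanding the product, the mixed terms vanish because distinct sources are independent
  and centred; the diagonal contributes the inverse precisions.\<close>

lemma
  shows integrable_lin_mult: "integrable M (\<lambda>\<omega>. lin p q r \<omega> * lin p' q' r' \<omega>)"
    and expectation_lin_mult: "expectation (\<lambda>\<omega>. lin p q r \<omega> * lin p' q' r' \<omega>)
      = p * p' / \<tau>\<^sub>\<theta> + q * q' / \<tau>\<^sub>g + (\<Sum>k=1..K. r k * r' k) / \<tau>\<^sub>y"
proof -
  define I where "I = insert None (Some ` {0..K})"
  have [simp]: "finite I" by (simp add: I_def)
  define a where "a i = (case i of None \<Rightarrow> p | Some k \<Rightarrow> if k = 0 then q else r k)" for i
  define b where "b i = (case i of None \<Rightarrow> p' | Some k \<Rightarrow> if k = 0 then q' else r' k)" for i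
  note mom = source_moments[folded I_def]
  have eq: "lin p q r \<omega> * lin p' q' r' \<omega> = (\<Sum>i\<in>I. \<Sum>j\<in>I. (a i * b j) * (source i \<omega> * source j \<omega>))" for \<omega>
    unfolding lin_eq_sum a_def[symmetric] b_def[symmetric] I_def[symmetric] sum_product
    by (simp add: ac_simps)
  show "integrable M (\<lambda>\<omega>. lin p q r \<omega> * lin p' q' r' \<omega>)"
    unfolding eq by (intro Bochner_Integration.integrable_sum integrable_mult_right mom)
  have "expectation (\<lambda>\<omega>. lin p q r \<omega> * lin p' q' r' \<omega>)
      = (\<Sum>i\<in>I. \<Sum>j\<in>I. (a i * b j) * expectation (\<lambda>\<omega>. source i \<omega> * source j \<omega>))"
    unfolding eq
    by (simp add: Bochner_Integration.integral_sum Bochner_Integration.integrable_sum mom)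
  also have "\<dots> = (\<Sum>i\<in>I. a i * b i * expectation (\<lambda>\<omega>. source i \<omega> * source i \<omega>))"
  proof (rule sum.cong[OF refl])
    fix i assume i: "i \<in> I"
    have "(\<Sum>j\<in>I. (a i * b j) * expectation (\<lambda>\<omega>. source i \<omega> * source j \<omega>))
       = (\<Sum>j\<in>I. if j = i then a i * b i * expectation (\<lambda>\<omega>. source i \<omega> * source i \<omega>) else 0)"
      using mom(4)[OF i] by (intro sum.cong) auto
    then show "(\<Sum>j\<in>I. (a i * b j) * expectation (\<lambda>\<omega>. source i \<omega> * source j \<omega>))
       = a i * b i * expectation (\<lambda>\<omega>. source i \<omega> * source i \<omega>)"
      using i by simp
  qed
  also have "\<dots> = p * p' / \<tau>\<^sub>\<theta> + (\<Sum>k=0..K. a (Some k) * b (Some k) * expectation (\<lambda>\<omega>. \<eta> k \<omega> * \<eta> k \<omega>))"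
  proof -
    have "expectation (\<lambda>\<omega>. \<theta> \<omega> * \<theta> \<omega>) = 1 / \<tau>\<^sub>\<theta>"
      using normal_distributed_moments(4)[OF _ distributed_sources(1)] pos by (simp add: power_divide)
    then show ?thesis
      unfolding I_def
      by (subst sum.insert) (auto simp: a_def b_def source_def sum.reindex)
  qed
  also have "(\<Sum>k=0..K. a (Some k) * b (Some k) * expectation (\<lambda>\<omega>. \<eta> k \<omega> * \<eta> k \<omega>))
      = q * q' / \<tau>\<^sub>g + (\<Sum>k=1..K. r k * r' k / \<tau>\<^sub>y)"
  proof -
    have "expectation (\<lambda>\<omega>. \<eta> 0 \<omega> * \<eta> 0 \<omega>) = 1 / \<tau>\<^sub>g"
      using normal_distributed_moments(4)[OF _ distributed_sources(2)] pos by (simp add: power_divide)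
    moreover have "expectation (\<lambda>\<omega>. \<eta> k \<omega> * \<eta> k \<omega>) = 1 / \<tau>\<^sub>y" if "k \<in> {1..K}" for k
      using normal_distributed_moments(4)[OF _ distributed_sources(3)[OF that]] pos by (simp add: power_divide)
    ultimately show ?thesis
      by (subst sum.atLeast_Suc_atMost) (auto simp: a_def b_def intro!: sum.cong)
  qed
  finally show "expectation (\<lambda>\<omega>. lin p q r \<omega> * lin p' q' r' \<omega>)
      = p * p' / \<tau>\<^sub>\<theta> + q * q' / \<tau>\<^sub>g + (\<Sum>k=1..K. r k * r' k) / \<tau>\<^sub>y"
    by (simp add: sum_divide_distrib)
qed


section \<open>The posterior mean as a precision-weighted average\<close>

lemma indep_pair_state_public_private:
  assumes k: "k \<in> {1..K}"
  shows "indep_pair (borel \<Otimes>\<^sub>M borel) (\<lambda>\<omega>. (\<theta> \<omega>, \<eta> 0 \<omega>)) borel (\<eta> k)"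
proof -
  have "indep_pair (PiM {None, Some 0} (\<lambda>_. borel)) (\<lambda>\<omega>. restrict (\<lambda>i. source i \<omega>) {None, Some 0})
      (PiM {Some k} (\<lambda>_. borel)) (\<lambda>\<omega>. restrict (\<lambda>i. source i \<omega>) {Some k})"
    unfolding indep_pair_iff_indep_var using k by (intro indep_var_restrict[OF indep_sources]) auto
  from indep_pair_compose[OF this, of "\<lambda>f. (f None, f (Some 0))" "borel \<Otimes>\<^sub>M borel" "\<lambda>f. f (Some k)" borel]
  show ?thesis by (simp add: source_def)
qed

lemma indep_pair_idio:
  assumes "j \<in> {1..K}" "k \<in> {1..K}" "j \<noteq> k"
  shows "indep_pair borel (\<lambda>\<omega>. common \<omega> + idio k \<omega>) borel (idio j)"
proof -
  let ?I = "{None, Some 0, Some k}"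
  have "indep_pair (PiM ?I (\<lambda>_. borel)) (\<lambda>\<omega>. restrict (\<lambda>i. source i \<omega>) ?I)
      (PiM {Some j} (\<lambda>_. borel)) (\<lambda>\<omega>. restrict (\<lambda>i. source i \<omega>) {Some j})"
    unfolding indep_pair_iff_indep_var using assms by (intro indep_var_restrict[OF indep_sources]) auto
  from indep_pair_compose[OF this,
      of "\<lambda>f. ((\<tau>\<^sub>g + \<tau>\<^sub>y) * f None + \<tau>\<^sub>g * f (Some 0)) / T + \<tau>\<^sub>y / T * f (Some k)" borel
         "\<lambda>f. \<tau>\<^sub>y / T * f (Some j)" borel]
  show ?thesis by (simp add: source_def common_def idio_def[abs_def])
qed

lemma indep_var_state_public: "indep_var borel \<theta> borel (\<eta> 0)"
  using indep_vars_imp_indep_var[OF indep_sources, of None "Some 0"] by (simp add: source_def)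

lemma posterior_residual_indep:
  assumes k: "k \<in> {1..K}"
  shows "indep_pair (borel \<Otimes>\<^sub>M borel) (\<lambda>\<omega>. (public_signal \<theta> \<eta> \<omega>, private_signal \<theta> \<eta> k \<omega>))
    borel (\<lambda>\<omega>. \<theta> \<omega> - (common \<omega> + idio k \<omega>))"
proof -
  define b where "b = \<tau>\<^sub>g / (\<tau>\<^sub>\<theta> + \<tau>\<^sub>g)"
  define r where "r \<omega> = \<theta> \<omega> - b * (\<theta> \<omega> + \<eta> 0 \<omega>)" for \<omega>
  define v where "v \<omega> = r \<omega> - \<tau>\<^sub>y / T * (r \<omega> + \<eta> k \<omega>)" for \<omega>
  have p: "0 < \<tau>\<^sub>\<theta> + \<tau>\<^sub>g" using pos by simp
  have weight: "(1 / a) / (1 / a + 1 / e) = e / (a + e)" if "0 < a" "0 < e" for a e :: real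
  proof -
    have "1 / a + 1 / e = (a + e) / (a * e)" using that by (simp add: field_simps)
    then show ?thesis using that by simp
  qed
  \<comment> \<open>In terms of precisions, the regression weight of \<theta> on the public signal
    is \<open>b\<close>, and the residual has precision
    \<open>\<tau>\<^sub>\<theta> + \<tau>\<^sub>g\<close>, the posterior precision after the public
    signal.\<close>
  have b: "(1 / sqrt \<tau>\<^sub>\<theta>)\<^sup>2 / ((1 / sqrt \<tau>\<^sub>\<theta>)\<^sup>2 + (1 / sqrt \<tau>\<^sub>g)\<^sup>2) = b"
    using pos weight[of "\<tau>\<^sub>\<theta>" "\<tau>\<^sub>g"] by (simp add: b_def power_divide)
  have \<sigma>\<^sub>r: "1 / sqrt \<tau>\<^sub>\<theta> * (1 / sqrt \<tau>\<^sub>g) / sqrt ((1 / sqrt \<tau>\<^sub>\<theta>)\<^sup>2 + (1 / sqrt \<tau>\<^sub>g)\<^sup>2)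
      = 1 / sqrt (\<tau>\<^sub>\<theta> + \<tau>\<^sub>g)"
  proof -
    have "(1 / sqrt \<tau>\<^sub>\<theta>)\<^sup>2 + (1 / sqrt \<tau>\<^sub>g)\<^sup>2 = (\<tau>\<^sub>\<theta> + \<tau>\<^sub>g) / (\<tau>\<^sub>\<theta> * \<tau>\<^sub>g)"
      using pos by (simp add: power_divide field_simps)
    then show ?thesis
      using pos by (simp add: real_sqrt_divide real_sqrt_mult)
  qed
  \<comment> \<open>Gram-Schmidt: \<open>v\<close> is what remains of \<open>\<theta>\<close> after successively removing its projections on the
    public signal and on the part \<open>r + \<eta> k\<close> of the private signal that is new.\<close>
  note step1 = gaussian_sum_residual[OF indep_var_state_public _ _ distributed_sources(1,2), unfolded b \<sigma>\<^sub>r,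
      folded r_def]
  have r: "distributed M lborel r (normal_density 0 (1 / sqrt (\<tau>\<^sub>\<theta> + \<tau>\<^sub>g)))"
    and gr: "indep_pair borel (public_signal \<theta> \<eta>) borel r"
    using step1 pos by (simp_all add: r_def[abs_def] public_signal_def[abs_def] indep_pair_iff_indep_var)
  have "indep_pair (borel \<Otimes>\<^sub>M borel)
      (\<lambda>\<omega>. (\<lambda>(t, e). (t + e, t - b * (t + e))) (\<theta> \<omega>, \<eta> 0 \<omega>)) borel (\<lambda>\<omega>. \<eta> k \<omega>)"
    by (rule indep_pair_compose[OF indep_pair_state_public_private[OF k]]) measurable
  then have "indep_pair (borel \<Otimes>\<^sub>M borel) (\<lambda>\<omega>. (public_signal \<theta> \<eta> \<omega>, r \<omega>)) borel (\<eta> k)"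
    by (simp add: r_def public_signal_def)
  \<comment> \<open>The public signal is independent of \<open>r\<close>, and both jointly of
    \<open>\<eta> k\<close>; regrouping makes the public signal independent of the pair
    \<open>(r, \<eta> k)\<close>.\<close>
  from indep_pair_Pair_assoc[OF gr this]
  have g_r\<eta>: "indep_pair borel (public_signal \<theta> \<eta>) (borel \<Otimes>\<^sub>M borel) (\<lambda>\<omega>. (r \<omega>, \<eta> k \<omega>))" .
  have "indep_pair borel (\<lambda>\<omega>. (\<lambda>(t, e). t - b * (t + e)) (\<theta> \<omega>, \<eta> 0 \<omega>)) borel (\<lambda>\<omega>. \<eta> k \<omega>)"
    by (rule indep_pair_compose[OF indep_pair_state_public_private[OF k]]) measurable
  then have r\<eta>: "indep_var borel r borel (\<eta> k)"
    by (simp add: r_def[abs_def] indep_pair_iff_indep_var)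
  have c: "(1 / sqrt (\<tau>\<^sub>\<theta> + \<tau>\<^sub>g))\<^sup>2 / ((1 / sqrt (\<tau>\<^sub>\<theta> + \<tau>\<^sub>g))\<^sup>2 + (1 / sqrt \<tau>\<^sub>y)\<^sup>2) = \<tau>\<^sub>y / T"
    using pos p weight[of "\<tau>\<^sub>\<theta> + \<tau>\<^sub>g" "\<tau>\<^sub>y"] by (simp add: T_def power_divide)
  have "indep_pair borel (\<lambda>\<omega>. r \<omega> + \<eta> k \<omega>) borel v"
    using gaussian_sum_residual(2)[OF r\<eta> _ _ r distributed_sources(3)[OF k], unfolded c] pos
    by (simp add: v_def[abs_def] indep_pair_iff_indep_var)
  then have vw: "indep_pair borel v borel (\<lambda>\<omega>. r \<omega> + \<eta> k \<omega>)"
    by (rule indep_pair_commute)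
  have "indep_pair (borel \<Otimes>\<^sub>M borel) (\<lambda>\<omega>. (\<lambda>(r, e). (r - \<tau>\<^sub>y / T * (r + e), r + e)) (r \<omega>, \<eta> k \<omega>))
      borel (\<lambda>\<omega>. public_signal \<theta> \<eta> \<omega>)"
    by (rule indep_pair_compose[OF indep_pair_commute[OF g_r\<eta>]]) measurable
  then have "indep_pair (borel \<Otimes>\<^sub>M borel) (\<lambda>\<omega>. (v \<omega>, r \<omega> + \<eta> k \<omega>)) borel (public_signal \<theta> \<eta>)"
    by (simp add: v_def)
  \<comment> \<open>The regrouping gives independence of \<open>v\<close> from the pair of the new
    part and the public signal, not merely from each of them.\<close>
  from indep_pair_Pair_assoc[OF vw this]
  have "indep_pair (borel \<Otimes>\<^sub>M borel) (\<lambda>\<omega>. (r \<omega> + \<eta> k \<omega>, public_signal \<theta> \<eta> \<omega>)) borel v"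
    by (rule indep_pair_commute)
  \<comment> \<open>Since \<open>r + \<eta> k\<close> is the private signal minus \<open>b\<close>
    times the public signal, this linear map recovers the pair of signals.\<close>
  then have "indep_pair (borel \<Otimes>\<^sub>M borel)
      (\<lambda>\<omega>. (\<lambda>(w, g). (g, w + b * g)) (r \<omega> + \<eta> k \<omega>, public_signal \<theta> \<eta> \<omega>)) borel (\<lambda>\<omega>. v \<omega>)"
    by (rule indep_pair_compose) measurable
  then have "indep_pair (borel \<Otimes>\<^sub>M borel) (\<lambda>\<omega>. (public_signal \<theta> \<eta> \<omega>, r \<omega> + \<eta> k \<omega> + b * public_signal \<theta> \<eta> \<omega>)) borel v"
    by simp
  also have "(\<lambda>\<omega>. (public_signal \<theta> \<eta> \<omega>, r \<omega> + \<eta> k \<omega> + b * public_signal \<theta> \<eta> \<omega>))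
      = (\<lambda>\<omega>. (public_signal \<theta> \<eta> \<omega>, private_signal \<theta> \<eta> k \<omega>))"
    by (simp add: r_def public_signal_def private_signal_def)
  also have "v = (\<lambda>\<omega>. \<theta> \<omega> - (common \<omega> + idio k \<omega>))"
  proof
    fix \<omega>
    \<comment> \<open>The two regression steps leave the public signal with weight
      \<open>(1 - \<tau>\<^sub>y / T) * b\<close>, which has to be its Bayes weight
      \<open>\<tau>\<^sub>g / T\<close>.\<close>
    have "1 - \<tau>\<^sub>y / T = (\<tau>\<^sub>\<theta> + \<tau>\<^sub>g) / T"
      using T_pos by (simp add: T_def diff_divide_eq_iff field_simps)
    then have "(1 - \<tau>\<^sub>y / T) * b = \<tau>\<^sub>g / T"
      using p by (simp add: b_def)
    moreover have "v \<omega> = \<theta> \<omega> - (1 - \<tau>\<^sub>y / T) * b * (\<theta> \<omega> + \<eta> 0 \<omega>) - \<tau>\<^sub>y / T * (\<theta> \<omega> + \<eta> k \<omega>)"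
      unfolding v_def r_def by (simp only: algebra_simps)
    ultimately have "v \<omega> = \<theta> \<omega> - \<tau>\<^sub>g / T * (\<theta> \<omega> + \<eta> 0 \<omega>) - \<tau>\<^sub>y / T * (\<theta> \<omega> + \<eta> k \<omega>)"
      by simp
    then show "v \<omega> = \<theta> \<omega> - (common \<omega> + idio k \<omega>)"
      by (simp add: common_def idio_def add_divide_distrib algebra_simps)
  qed
  finally show ?thesis .
qed

lemma common_idio_eq_lin:
  "k \<in> {1..K} \<Longrightarrow> (\<lambda>\<omega>. common \<omega> + idio k \<omega>)
    = lin ((\<tau>\<^sub>g + \<tau>\<^sub>y) / T) (\<tau>\<^sub>g / T) (\<lambda>j. if j = k then \<tau>\<^sub>y / T else 0)"
  by (simp add: fun_eq_iff lin_def common_def idio_def add_divide_distrib distrib_right if_distrib[of "\<lambda>a. a * _"]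
      cong: if_cong)

lemma state_eq_lin: "\<theta> = lin 1 0 (\<lambda>_. 0)"
  by (simp add: fun_eq_iff lin_def)

lemma posterior_mean_eq:
  assumes k: "k \<in> {1..K}"
  shows "AE \<omega> in M. m k \<omega> = common \<omega> + idio k \<omega>"
proof -
  let ?U = "\<lambda>\<omega>. (public_signal \<theta> \<eta> \<omega>, private_signal \<theta> \<eta> k \<omega>)"
  \<comment> \<open>The precision-weighted average of the signals; the prior mean has weight
    \<open>\<tau>\<^sub>\<theta> / T\<close> but is 0.\<close>
  define h where "h = (\<lambda>(a, b). (\<tau>\<^sub>g * a + \<tau>\<^sub>y * b) / T)"
  have hU: "h (?U \<omega>) = common \<omega> + idio k \<omega>" for \<omega>
    by (simp add: h_def public_signal_def private_signal_def common_def idio_def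
        add_divide_distrib algebra_simps)
  have "AE \<omega> in M. cond_expectation_given M (borel \<Otimes>\<^sub>M borel) ?U \<theta> \<omega> = h (?U \<omega>)"
  proof (rule cond_expectation_given_eqI)
    show "?U \<in> M \<rightarrow>\<^sub>M borel \<Otimes>\<^sub>M borel"
      using posterior_residual_indep[OF k] by (rule indep_pair_rv1)
    show "integrable M \<theta>" by (subst state_eq_lin) simp
    show "h \<in> borel_measurable (borel \<Otimes>\<^sub>M borel)" unfolding h_def by measurable
    show "integrable M (\<lambda>\<omega>. h (?U \<omega>))" unfolding hU by (simp add: common_idio_eq_lin[OF k])
    show "expectation (\<lambda>\<omega>. indicator B (?U \<omega>) * (\<theta> \<omega> - h (?U \<omega>))) = 0"
      if "B \<in> sets (borel \<Otimes>\<^sub>M borel)" for B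
      unfolding hU
    proof (rule indep_pair_integral_indicator_mult[OF posterior_residual_indep[OF k] _ _ that])
      have 1: "integrable M \<theta>" "expectation \<theta> = 0" by (subst state_eq_lin, simp)+
      have 2: "integrable M (\<lambda>\<omega>. common \<omega> + idio k \<omega>)" "expectation (\<lambda>\<omega>. common \<omega> + idio k \<omega>) = 0"
        by (simp_all add: common_idio_eq_lin[OF k])
      show "integrable M (\<lambda>\<omega>. \<theta> \<omega> - (common \<omega> + idio k \<omega>))"
        using 1 2 by (intro Bochner_Integration.integrable_diff)
      show "expectation (\<lambda>\<omega>. \<theta> \<omega> - (common \<omega> + idio k \<omega>)) = 0"
        using 1 2 by (subst Bochner_Integration.integral_diff) auto
    qed
  qed
  then show ?thesis
    unfolding posterior_mean_def hU .
qed

end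

section \<open>Predicting the aggregate action\<close>

text \<open>The payoff is a strictly concave quadratic in the action, and its shortfall from the
  maximum is exactly \<beta> times the squared distance to the solution \<open>b'\<close> of the
  first-order condition. Hence that condition is both necessary and sufficient.\<close>

lemma payoff_maximal_iff:
  assumes "0 < \<beta>"
  shows "(\<forall>a. payoff \<psi> \<xi> c \<beta> d \<mu> e a \<le> payoff \<psi> \<xi> c \<beta> d \<mu> e b)
    \<longleftrightarrow> 2 * \<beta> * b = \<psi> + \<xi> * \<mu> + \<beta> * c + d * e"
proof -
  define b' where "b' = (\<psi> + \<xi> * \<mu> + \<beta> * c + d * e) / (2 * \<beta>)"
  have b': "2 * \<beta> * b' = \<psi> + \<xi> * \<mu> + \<beta> * c + d * e"
    using assms by (simp add: b'_def)
  have diff: "payoff \<psi> \<xi> c \<beta> d \<mu> e b' - payoff \<psi> \<xi> c \<beta> d \<mu> e a = \<beta> * (b' - a)\<^sup>2" for a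
  proof -
    have p: "payoff \<psi> \<xi> c \<beta> d \<mu> e t = (t - c) * (2 * \<beta> * b' - \<beta> * c - \<beta> * t)" for t
      unfolding b' payoff_def by (simp add: algebra_simps)
    show ?thesis
      unfolding p by (simp add: algebra_simps power2_eq_square)
  qed
  show ?thesis
  proof
    assume "\<forall>a. payoff \<psi> \<xi> c \<beta> d \<mu> e a \<le> payoff \<psi> \<xi> c \<beta> d \<mu> e b"
    then have "\<beta> * (b' - b)\<^sup>2 \<le> 0"
      unfolding diff[symmetric] by simp
    then have "b' = b"
      using assms by (simp add: mult_le_0_iff)
    then show "2 * \<beta> * b = \<psi> + \<xi> * \<mu> + \<beta> * c + d * e"
      using b' by simp
  next
    assume "2 * \<beta> * b = \<psi> + \<xi> * \<mu> + \<beta> * c + d * e"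
    then have "b = b'"
      using assms by (simp add: b'_def field_simps)
    then show "\<forall>a. payoff \<psi> \<xi> c \<beta> d \<mu> e a \<le> payoff \<psi> \<xi> c \<beta> d \<mu> e b"
      using diff assms by (metis diff_ge_0_iff_ge less_imp_le mult_nonneg_nonneg zero_le_power2)
  qed
qed

context signal_model
begin

lemma var_common_scaled:
  "((\<tau>\<^sub>g + \<tau>\<^sub>y) / T * s)\<^sup>2 / \<tau>\<^sub>\<theta> + (\<tau>\<^sub>g / T * s)\<^sup>2 / \<tau>\<^sub>g = var_common * s\<^sup>2"
proof -
  have "(\<tau>\<^sub>g / T * s)\<^sup>2 / \<tau>\<^sub>g = \<tau>\<^sub>g / T\<^sup>2 * s\<^sup>2"
    using pos by (simp add: power2_eq_square)
  moreover have "(u / T * s)\<^sup>2 / \<tau>\<^sub>\<theta> = u\<^sup>2 / \<tau>\<^sub>\<theta> / T\<^sup>2 * s\<^sup>2" for u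
    by (simp add: power2_eq_square ac_simps)
  ultimately show ?thesis
    unfolding var_common_def add_divide_distrib[of _ _ "T\<^sup>2"] distrib_right[of _ _ "s\<^sup>2"] by simp
qed

lemma measurable_lin [measurable]: "lin p q r \<in> borel_measurable M"
  by (rule borel_measurable_integrable) simp

lemma measurable_posterior_mean [measurable]: "m k \<in> borel_measurable M"
  by (simp add: posterior_mean_def cond_expectation_given_def)

lemma measurable_common_idio:
  "k \<in> {1..K} \<Longrightarrow> (\<lambda>\<omega>. common \<omega> + idio k \<omega>) \<in> borel_measurable M"
  by (simp add: common_idio_eq_lin measurable_lin)

lemma posterior_mean_moments:
  assumes k: "k \<in> {1..K}"
  shows "integrable M (m k)" "expectation (m k) = 0"
    "integrable M (\<lambda>\<omega>. m k \<omega> * m k \<omega>)"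
    "expectation (\<lambda>\<omega>. m k \<omega> * m k \<omega>) = var_common + var_idio"
proof -
  note [measurable] = measurable_common_idio[OF k]
  have eq: "AE \<omega> in M. m k \<omega> = common \<omega> + idio k \<omega>"
    by (rule posterior_mean_eq[OF k])
  have eq2: "AE \<omega> in M. m k \<omega> * m k \<omega> = (common \<omega> + idio k \<omega>) * (common \<omega> + idio k \<omega>)"
    using eq by eventually_elim simp
  note lin = common_idio_eq_lin[OF k, THEN fun_cong]
  show "integrable M (m k)"
    by (subst integrable_cong_AE[OF _ _ eq]) (simp_all add: lin measurable_lin)
  show "expectation (m k) = 0"
    by (subst integral_cong_AE[OF _ _ eq]) (simp_all add: lin measurable_lin)
  show "integrable M (\<lambda>\<omega>. m k \<omega> * m k \<omega>)"
    by (subst integrable_cong_AE[OF _ _ eq2]) (simp_all add: lin integrable_lin_mult measurable_lin)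
  have "expectation (\<lambda>\<omega>. m k \<omega> * m k \<omega>)
      = expectation (\<lambda>\<omega>. (common \<omega> + idio k \<omega>) * (common \<omega> + idio k \<omega>))"
    by (rule integral_cong_AE[OF _ _ eq2]) simp_all
  also have "\<dots> = (((\<tau>\<^sub>g + \<tau>\<^sub>y) / T)\<^sup>2 / \<tau>\<^sub>\<theta> + (\<tau>\<^sub>g / T)\<^sup>2 / \<tau>\<^sub>g) + (\<tau>\<^sub>y / T)\<^sup>2 / \<tau>\<^sub>y"
    unfolding lin expectation_lin_mult using k
    by (simp add: power2_eq_square if_distrib[of "\<lambda>a. a * _"] cong: if_cong)
  also have "\<dots> = var_common + var_idio"
    using pos var_common_scaled[of 1] by (simp add: var_idio_def power2_eq_square)
  finally show "expectation (\<lambda>\<omega>. m k \<omega> * m k \<omega>) = var_common + var_idio" .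
qed

text \<open>Allows coefficients to be compared in identities that hold only almost surely: the mean
  of \<open>m k\<close> is zero, which isolates \<open>p\<close>, and its second moment is positive,
  which forces \<open>q\<close> to vanish.\<close>

lemma posterior_mean_affine_zero:
  assumes k: "k \<in> {1..K}" and ae: "AE \<omega> in M. p + q * m k \<omega> = 0"
  shows "p = 0 \<and> q = 0"
proof -
  note mom = posterior_mean_moments[OF k]
  have "expectation (\<lambda>\<omega>. p + q * m k \<omega>) = 0"
    using integral_cong_AE[OF _ _ ae] by simp
  then have p: "p = 0"
    using mom by (simp add: prob_space)
  have "AE \<omega> in M. q * (m k \<omega> * m k \<omega>) = 0"
    using ae by eventually_elim (use p in auto)
  then have "expectation (\<lambda>\<omega>. q * (m k \<omega> * m k \<omega>)) = 0"
    using integral_cong_AE[of "\<lambda>\<omega>. q * (m k \<omega> * m k \<omega>)" M "\<lambda>_. 0"] by simp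
  then show ?thesis
    using mom p var_common_pos var_idio_pos by simp
qed

text \<open>\<open>common\<close> and \<open>idio k\<close> are independent centred normals, and by
  \<open>rho_eq\<close> the regression coefficient of the first on their sum is \<rho>.\<close>

lemma common_residual_indep:
  assumes k: "k \<in> {1..K}"
  shows "indep_pair borel (\<lambda>\<omega>. common \<omega> + idio k \<omega>)
    borel (\<lambda>\<omega>. common \<omega> - \<rho> * (common \<omega> + idio k \<omega>))"
proof -
  have "indep_pair borel (\<lambda>\<omega>. (\<lambda>(t, e). ((\<tau>\<^sub>g + \<tau>\<^sub>y) * t + \<tau>\<^sub>g * e) / T) (\<theta> \<omega>, \<eta> 0 \<omega>))
      borel (\<lambda>\<omega>. \<tau>\<^sub>y / T * \<eta> k \<omega>)"
    by (rule indep_pair_compose[OF indep_pair_state_public_private[OF k]]) measurable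
  then have ind: "indep_var borel common borel (idio k)"
    by (simp add: common_def[abs_def] idio_def[abs_def] indep_pair_iff_indep_var)
  have "distributed M lborel (\<lambda>\<omega>. 0 + (\<tau>\<^sub>g + \<tau>\<^sub>y) / T * \<theta> \<omega>)
      (normal_density (0 + (\<tau>\<^sub>g + \<tau>\<^sub>y) / T * 0) (\<bar>(\<tau>\<^sub>g + \<tau>\<^sub>y) / T\<bar> * (1 / sqrt \<tau>\<^sub>\<theta>)))"
    using pos T_pos by (intro normal_density_affine distributed_sources) auto
  moreover have "distributed M lborel (\<lambda>\<omega>. 0 + \<tau>\<^sub>g / T * \<eta> 0 \<omega>)
      (normal_density (0 + \<tau>\<^sub>g / T * 0) (\<bar>\<tau>\<^sub>g / T\<bar> * (1 / sqrt \<tau>\<^sub>g)))"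
    using pos T_pos by (intro normal_density_affine distributed_sources) auto
  moreover have "indep_var borel (\<lambda>\<omega>. 0 + (\<tau>\<^sub>g + \<tau>\<^sub>y) / T * \<theta> \<omega>) borel (\<lambda>\<omega>. 0 + \<tau>\<^sub>g / T * \<eta> 0 \<omega>)"
    unfolding indep_pair_iff_indep_var[symmetric]
    by (rule indep_pair_compose[OF indep_var_state_public[folded indep_pair_iff_indep_var]]) measurable
  ultimately have "distributed M lborel (\<lambda>\<omega>. (0 + (\<tau>\<^sub>g + \<tau>\<^sub>y) / T * \<theta> \<omega>) + (0 + \<tau>\<^sub>g / T * \<eta> 0 \<omega>))
      (normal_density (0 + (\<tau>\<^sub>g + \<tau>\<^sub>y) / T * 0 + (0 + \<tau>\<^sub>g / T * 0))
        (sqrt ((\<bar>(\<tau>\<^sub>g + \<tau>\<^sub>y) / T\<bar> * (1 / sqrt \<tau>\<^sub>\<theta>))\<^sup>2 + (\<bar>\<tau>\<^sub>g / T\<bar> * (1 / sqrt \<tau>\<^sub>g))\<^sup>2)))"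
    using pos T_pos by (intro add_indep_normal) auto
  also have "(\<lambda>\<omega>. (0 + (\<tau>\<^sub>g + \<tau>\<^sub>y) / T * \<theta> \<omega>) + (0 + \<tau>\<^sub>g / T * \<eta> 0 \<omega>)) = common"
    by (simp add: fun_eq_iff common_def add_divide_distrib distrib_right)
  also have "(\<bar>(\<tau>\<^sub>g + \<tau>\<^sub>y) / T\<bar> * (1 / sqrt \<tau>\<^sub>\<theta>))\<^sup>2 + (\<bar>\<tau>\<^sub>g / T\<bar> * (1 / sqrt \<tau>\<^sub>g))\<^sup>2 = var_common"
    using pos T_pos var_common_scaled[of 1] by (simp add: power_mult_distrib power_divide)
  finally have C: "distributed M lborel common (normal_density 0 (sqrt var_common))"
    by simp
  have "distributed M lborel (\<lambda>\<omega>. 0 + \<tau>\<^sub>y / T * \<eta> k \<omega>)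
      (normal_density (0 + \<tau>\<^sub>y / T * 0) (\<bar>\<tau>\<^sub>y / T\<bar> * (1 / sqrt \<tau>\<^sub>y)))"
    using pos T_pos k by (intro normal_density_affine distributed_sources) auto
  also have "\<bar>\<tau>\<^sub>y / T\<bar> * (1 / sqrt \<tau>\<^sub>y) = sqrt var_idio"
    using pos T_pos by (simp add: var_idio_def real_sqrt_divide field_simps)
  finally have Y: "distributed M lborel (idio k) (normal_density 0 (sqrt var_idio))"
    by (simp add: idio_def[abs_def])
  show ?thesis
    using gaussian_sum_residual(2)[OF ind _ _ C Y] var_common_pos var_idio_pos
    by (simp add: rho_eq indep_pair_iff_indep_var)
qed

text \<open>Almost surely \<open>m j - \<rho> * m k\<close> is the sum of
  \<open>common - \<rho> * m k\<close> and \<open>idio j\<close>. Both are centred and independent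
  of \<open>m k\<close>: the first as a Gaussian residual, the second because it involves only the
  noise of \<open>j\<close>.\<close>

lemma posterior_mean_prediction_residual:
  assumes jk: "j \<in> {1..K}" "k \<in> {1..K}" "j \<noteq> k" and B: "B \<in> sets borel"
  shows "expectation (\<lambda>\<omega>. indicator B (m k \<omega>) * (m j \<omega> - \<rho> * m k \<omega>)) = 0"
proof -
  let ?m = "\<lambda>k \<omega>. common \<omega> + idio k \<omega>"
  note [measurable] = B measurable_common_idio[OF jk(1)] measurable_common_idio[OF jk(2)]
  have common_lin: "common = lin ((\<tau>\<^sub>g + \<tau>\<^sub>y) / T) (\<tau>\<^sub>g / T) (\<lambda>_. 0)"
    by (simp add: fun_eq_iff lin_def common_def add_divide_distrib distrib_right)
  have idio_lin: "idio j = lin 0 0 (\<lambda>i. if i = j then \<tau>\<^sub>y / T else 0)"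
    using jk by (simp add: fun_eq_iff lin_def idio_def if_distrib[of "\<lambda>a. a * _"] cong: if_cong)
  have C: "integrable M common" "expectation common = 0"
    by (simp_all add: common_lin)
  have Y: "integrable M (idio j)" "expectation (idio j) = 0"
    by (simp_all add: idio_lin)
  have mk: "integrable M (?m k)" "expectation (?m k) = 0"
    by (simp_all add: common_idio_eq_lin[OF jk(2)])
  have R: "integrable M (\<lambda>\<omega>. common \<omega> - \<rho> * ?m k \<omega>)" "expectation (\<lambda>\<omega>. common \<omega> - \<rho> * ?m k \<omega>) = 0"
    using C mk by simp_all
  have ind_int: "integrable M (\<lambda>\<omega>. indicator B (?m k \<omega>) * X \<omega>)" if "integrable M X" for X :: "'a \<Rightarrow> real"
    using that by (intro Bochner_Integration.integrable_bound[OF that])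
      (auto simp: indicator_def intro!: borel_measurable_integrable)
  have "expectation (\<lambda>\<omega>. indicator B (m k \<omega>) * (m j \<omega> - \<rho> * m k \<omega>))
      = expectation (\<lambda>\<omega>. indicator B (?m k \<omega>) * (?m j \<omega> - \<rho> * ?m k \<omega>))"
    using posterior_mean_eq[OF jk(1)] posterior_mean_eq[OF jk(2)]
    by (intro integral_cong_AE) (auto elim!: eventually_elim2)
  also have "\<dots> = expectation (\<lambda>\<omega>. indicator B (?m k \<omega>) * (common \<omega> - \<rho> * ?m k \<omega>)
      + indicator B (?m k \<omega>) * idio j \<omega>)"
    by (intro Bochner_Integration.integral_cong) (simp_all add: algebra_simps)
  also have "\<dots> = expectation (\<lambda>\<omega>. indicator B (?m k \<omega>) * (common \<omega> - \<rho> * ?m k \<omega>))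
      + expectation (\<lambda>\<omega>. indicator B (?m k \<omega>) * idio j \<omega>)"
    by (intro Bochner_Integration.integral_add ind_int R Y)
  also have "\<dots> = 0"
    using indep_pair_integral_indicator_mult[OF common_residual_indep[OF jk(2)] R B]
      indep_pair_integral_indicator_mult[OF indep_pair_idio[OF jk] Y B] by simp
  finally show ?thesis .
qed

text \<open>A client knows the posterior mean of its own provider exactly and predicts the others
  with factor \<rho>. The excess \<open>1 - \<rho>\<close> on the own term is the channel through
  which the share \<open>x k\<close> enters the slope of provider \<open>k\<close>.\<close>

lemma aggregate_action_prediction:
  assumes k: "k \<in> {1..K}"
  shows "AE \<omega> in M. cond_expectation_given M borel (m k) (aggregate_action K m x \<alpha> \<gamma>) \<omega>
    = (\<Sum>j=1..K. x j * \<alpha> j)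
      + (\<rho> * (\<Sum>j=1..K. x j * \<gamma> j) + (1 - \<rho>) * x k * \<gamma> k) * m k \<omega>"
proof -
  let ?w = "\<lambda>j. if j = k then 1 else \<rho>"
  let ?a = "\<Sum>j=1..K. x j * \<alpha> j" and ?b = "\<Sum>j=1..K. x j * \<gamma> j * ?w j"
  have b: "?b = \<rho> * (\<Sum>j=1..K. x j * \<gamma> j) + (1 - \<rho>) * x k * \<gamma> k"
  proof -
    have "?b = (\<Sum>j=1..K. \<rho> * (x j * \<gamma> j) + (if j = k then (1 - \<rho>) * x k * \<gamma> k else 0))"
      by (intro sum.cong) (auto simp: algebra_simps)
    then show ?thesis
      using k by (simp add: sum.distrib sum_distrib_left)
  qed
  have "AE \<omega> in M. cond_expectation_given M borel (m k) (aggregate_action K m x \<alpha> \<gamma>) \<omega>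
      = (\<lambda>t. ?a + ?b * t) (m k \<omega>)"
  proof (rule cond_expectation_given_eqI)
    show "integrable M (aggregate_action K m x \<alpha> \<gamma>)"
      unfolding aggregate_action_def[abs_def] affine_action_def
      by (intro Bochner_Integration.integrable_sum integrable_mult_right
          Bochner_Integration.integrable_add integrable_const posterior_mean_moments)
    show "integrable M (\<lambda>\<omega>. ?a + ?b * m k \<omega>)"
      by (intro integrable_mult_right Bochner_Integration.integrable_add integrable_const
          posterior_mean_moments k)
    fix B :: "real set" assume B: "B \<in> sets borel"
    note [measurable] = B
    have res: "aggregate_action K m x \<alpha> \<gamma> \<omega> - (?a + ?b * m k \<omega>)
        = (\<Sum>j=1..K. x j * \<gamma> j * (m j \<omega> - ?w j * m k \<omega>))" for \<omega>
    proof -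
      have "(\<Sum>j=1..K. x j * \<gamma> j * (m j \<omega> - ?w j * m k \<omega>))
          = (\<Sum>j=1..K. x j * \<gamma> j * m j \<omega>) - (\<Sum>j=1..K. x j * \<gamma> j * ?w j * m k \<omega>)"
        unfolding sum_subtractf[symmetric] by (rule sum.cong) (auto simp: algebra_simps)
      moreover have "aggregate_action K m x \<alpha> \<gamma> \<omega> = ?a + (\<Sum>j=1..K. x j * \<gamma> j * m j \<omega>)"
        unfolding aggregate_action_def affine_action_def sum.distrib[symmetric]
        by (rule sum.cong) (auto simp: algebra_simps)
      ultimately show ?thesis
        by (simp add: sum_distrib_right)
    qed
    have int: "integrable M (\<lambda>\<omega>. indicator B (m k \<omega>) * (m j \<omega> - ?w j * m k \<omega>))" if "j \<in> {1..K}" for j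
    proof -
      have "integrable M (\<lambda>\<omega>. m j \<omega> - ?w j * m k \<omega>)"
        using posterior_mean_moments k that by (intro Bochner_Integration.integrable_diff integrable_mult_right)
      then show ?thesis
        by (rule Bochner_Integration.integrable_bound) (auto simp: indicator_def)
    qed
    have "expectation (\<lambda>\<omega>. indicator B (m k \<omega>) * (aggregate_action K m x \<alpha> \<gamma> \<omega> - (?a + ?b * m k \<omega>)))
        = expectation (\<lambda>\<omega>. \<Sum>j=1..K. x j * \<gamma> j * (indicator B (m k \<omega>) * (m j \<omega> - ?w j * m k \<omega>)))"
      unfolding res sum_distrib_left
      by (intro Bochner_Integration.integral_cong sum.cong) (simp_all only: ac_simps)
    also have "\<dots> = (\<Sum>j=1..K. x j * \<gamma> j * expectation (\<lambda>\<omega>. indicator B (m k \<omega>) * (m j \<omega> - ?w j * m k \<omega>)))"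
      using int by (subst Bochner_Integration.integral_sum) simp_all
    also have "\<dots> = 0"
      using posterior_mean_prediction_residual[OF _ k _ B] by (intro sum.neutral) auto
    finally show "expectation (\<lambda>\<omega>. indicator B (m k \<omega>)
        * (aggregate_action K m x \<alpha> \<gamma> \<omega> - (?a + ?b * m k \<omega>))) = 0" .
  qed simp_all
  then show ?thesis
    unfolding b .
qed

text \<open>After inserting the prediction of the aggregate, the first-order condition of provider
  \<open>k\<close> is affine in \<open>m k\<close>; its constant and its linear coefficient must
  vanish separately. Intercepts and slopes thereby decouple.\<close>

lemma affine_equilibrium_iff:
  assumes \<beta>: "0 < \<beta>"
  shows "affine_equilibrium M K m \<psi> \<xi> c \<beta> d x \<alpha> \<gamma> \<longleftrightarrow>
    \<alpha> \<in> extensional {1..K} \<and> \<gamma> \<in> extensional {1..K} \<and>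
    (\<forall>k\<in>{1..K}. 2 * \<beta> * \<alpha> k = \<psi> + \<beta> * c + d * (\<Sum>j=1..K. x j * \<alpha> j) \<and>
      2 * \<beta> * \<gamma> k = \<xi> + d * (\<rho> * (\<Sum>j=1..K. x j * \<gamma> j) + (1 - \<rho>) * x k * \<gamma> k))"
proof -
  let ?a = "\<Sum>j=1..K. x j * \<alpha> j"
  let ?b = "\<lambda>k. \<rho> * (\<Sum>j=1..K. x j * \<gamma> j) + (1 - \<rho>) * x k * \<gamma> k"
  have "(AE \<omega> in M. \<forall>a.
        payoff \<psi> \<xi> c \<beta> d (m k \<omega>)
          (cond_expectation_given M borel (m k) (aggregate_action K m x \<alpha> \<gamma>) \<omega>) a
        \<le> payoff \<psi> \<xi> c \<beta> d (m k \<omega>)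
          (cond_expectation_given M borel (m k) (aggregate_action K m x \<alpha> \<gamma>) \<omega>)
          (affine_action m \<alpha> \<gamma> k \<omega>))
      \<longleftrightarrow> 2 * \<beta> * \<alpha> k = \<psi> + \<beta> * c + d * ?a \<and> 2 * \<beta> * \<gamma> k = \<xi> + d * ?b k" (is "?L \<longleftrightarrow> ?R")
    if k: "k \<in> {1..K}" for k
  proof -
    let ?p = "2 * \<beta> * \<alpha> k - (\<psi> + \<beta> * c + d * ?a)" and ?q = "2 * \<beta> * \<gamma> k - (\<xi> + d * ?b k)"
    note pred = aggregate_action_prediction[OF k, of x \<alpha> \<gamma>]
    have split: "2 * \<beta> * (s + g * t) - (\<psi> + \<xi> * t + \<beta> * c + d * (e + f * t))
        = (2 * \<beta> * s - (\<psi> + \<beta> * c + d * e)) + (2 * \<beta> * g - (\<xi> + d * f)) * t" for s g t e f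
      by (simp add: algebra_simps)
    show ?thesis
      unfolding payoff_maximal_iff[OF \<beta>]
    proof
      assume "AE \<omega> in M. 2 * \<beta> * affine_action m \<alpha> \<gamma> k \<omega> = \<psi> + \<xi> * m k \<omega> + \<beta> * c
          + d * cond_expectation_given M borel (m k) (aggregate_action K m x \<alpha> \<gamma>) \<omega>"
      with pred have "AE \<omega> in M. ?p + ?q * m k \<omega> = 0"
        by eventually_elim (simp only: affine_action_def split[symmetric] diff_self)
      from posterior_mean_affine_zero[OF k this] show ?R
        by simp
    next
      assume ?R
      then have "?p = 0" "?q = 0" by simp_all
      then have R: "2 * \<beta> * (\<alpha> k + \<gamma> k * t) = \<psi> + \<xi> * t + \<beta> * c + d * (?a + ?b k * t)" for t
        using split[of "\<alpha> k" "\<gamma> k" t ?a "?b k"] by (simp only: diff_self mult_zero_left add_0 right_minus_eq)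
      from pred show "AE \<omega> in M. 2 * \<beta> * affine_action m \<alpha> \<gamma> k \<omega> = \<psi> + \<xi> * m k \<omega> + \<beta> * c
          + d * cond_expectation_given M borel (m k) (aggregate_action K m x \<alpha> \<gamma>) \<omega>"
        by eventually_elim (simp only: affine_action_def R)
    qed
  qed
  then show ?thesis
    unfolding affine_equilibrium_def by blast
qed

section \<open>Moments of the aggregate action\<close>

lemma aggregate_action_eq_lin:
  "AE \<omega> in M. aggregate_action K m x \<alpha> \<gamma> \<omega> = (\<Sum>k=1..K. x k * \<alpha> k)
    + lin ((\<tau>\<^sub>g + \<tau>\<^sub>y) / T * response_coefficient K x \<gamma>) (\<tau>\<^sub>g / T * response_coefficient K x \<gamma>)
        (\<lambda>k. \<tau>\<^sub>y / T * (x k * \<gamma> k)) \<omega>"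
proof -
  have "AE \<omega> in M. \<forall>k\<in>{1..K}. m k \<omega> = common \<omega> + idio k \<omega>"
    using posterior_mean_eq by (subst AE_finite_all) auto
  then show ?thesis
  proof eventually_elim
    case (elim \<omega>)
    have "aggregate_action K m x \<alpha> \<gamma> \<omega>
        = (\<Sum>k=1..K. x k * \<alpha> k + (x k * \<gamma> k * common \<omega> + x k * \<gamma> k * idio k \<omega>))"
      unfolding aggregate_action_def affine_action_def
      using elim by (intro sum.cong) (auto simp: algebra_simps)
    also have "\<dots> = (\<Sum>k=1..K. x k * \<alpha> k) + (response_coefficient K x \<gamma> * common \<omega>
        + (\<Sum>k=1..K. \<tau>\<^sub>y / T * (x k * \<gamma> k) * \<eta> k \<omega>))"
      unfolding sum.distrib response_coefficient_def idio_def sum_distrib_right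
      by (simp add: ac_simps)
    also have "response_coefficient K x \<gamma> * common \<omega> = (\<tau>\<^sub>g + \<tau>\<^sub>y) / T * response_coefficient K x \<gamma> * \<theta> \<omega>
        + \<tau>\<^sub>g / T * response_coefficient K x \<gamma> * \<eta> 0 \<omega>"
      by (simp add: common_def add_divide_distrib algebra_simps)
    finally show ?case
      by (simp add: lin_def)
  qed
qed

lemma measurable_aggregate_action [measurable]:
  "aggregate_action K m x \<alpha> \<gamma> \<in> borel_measurable M"
  unfolding aggregate_action_def[abs_def] affine_action_def by measurable

lemma expectation_aggregate_action:
  "expectation (aggregate_action K m x \<alpha> \<gamma>) = (\<Sum>k=1..K. x k * \<alpha> k)"
  by (subst integral_cong_AE[OF _ _ aggregate_action_eq_lin]) (simp_all add: prob_space)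

text \<open>The state is the only source with a nonzero coefficient in both variables. The factor in
  front of the response coefficient is the variance of a posterior mean.\<close>

lemma cov_aggregate_action:
  "cov M (aggregate_action K m x \<alpha> \<gamma>) \<theta> = (\<tau>\<^sub>g + \<tau>\<^sub>y) / (T * \<tau>\<^sub>\<theta>) * response_coefficient K x \<gamma>"
proof -
  let ?lin = "lin ((\<tau>\<^sub>g + \<tau>\<^sub>y) / T * response_coefficient K x \<gamma>) (\<tau>\<^sub>g / T * response_coefficient K x \<gamma>)
        (\<lambda>k. \<tau>\<^sub>y / T * (x k * \<gamma> k))"
  have [measurable]: "\<theta> \<in> borel_measurable M" and "expectation \<theta> = 0"
    by (subst state_eq_lin, simp)+
  then have "cov M (aggregate_action K m x \<alpha> \<gamma>) \<theta>
      = expectation (\<lambda>\<omega>. (aggregate_action K m x \<alpha> \<gamma> \<omega> - (\<Sum>k=1..K. x k * \<alpha> k)) * \<theta> \<omega>)"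
    by (simp add: cov_def expectation_aggregate_action)
  also have "\<dots> = expectation (\<lambda>\<omega>. ?lin \<omega> * lin 1 0 (\<lambda>_. 0) \<omega>)"
  proof (rule integral_cong_AE)
    show "AE \<omega> in M. (aggregate_action K m x \<alpha> \<gamma> \<omega> - (\<Sum>k=1..K. x k * \<alpha> k)) * \<theta> \<omega>
        = ?lin \<omega> * lin 1 0 (\<lambda>_. 0) \<omega>"
      using aggregate_action_eq_lin[of x \<alpha> \<gamma>]
      by eventually_elim (simp add: state_eq_lin[symmetric])
  qed measurable
  also have "\<dots> = (\<tau>\<^sub>g + \<tau>\<^sub>y) / (T * \<tau>\<^sub>\<theta>) * response_coefficient K x \<gamma>"
    by (simp add: expectation_lin_mult)
  finally show ?thesis .
qed

text \<open>Shared shocks enter through the total response, whereas independent private noises add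
  up in squares, so concentration matters also through the sum of squared weighted slopes.\<close>

lemma variance_aggregate_action:
  "variance (aggregate_action K m x \<alpha> \<gamma>)
    = var_common * (response_coefficient K x \<gamma>)\<^sup>2 + var_idio * (\<Sum>k=1..K. (x k * \<gamma> k)\<^sup>2)"
proof -
  let ?lin = "lin ((\<tau>\<^sub>g + \<tau>\<^sub>y) / T * response_coefficient K x \<gamma>) (\<tau>\<^sub>g / T * response_coefficient K x \<gamma>)
        (\<lambda>k. \<tau>\<^sub>y / T * (x k * \<gamma> k))"
  have "variance (aggregate_action K m x \<alpha> \<gamma>) = expectation (\<lambda>\<omega>. ?lin \<omega> * ?lin \<omega>)"
    unfolding expectation_aggregate_action
  proof (rule integral_cong_AE)
    show "AE \<omega> in M. (aggregate_action K m x \<alpha> \<gamma> \<omega> - (\<Sum>k=1..K. x k * \<alpha> k))\<^sup>2 = ?lin \<omega> * ?lin \<omega>"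
      using aggregate_action_eq_lin[of x \<alpha> \<gamma>]
      by eventually_elim (simp add: power2_eq_square)
  qed measurable
  also have "\<dots> = ((\<tau>\<^sub>g + \<tau>\<^sub>y) / T * response_coefficient K x \<gamma>)\<^sup>2 / \<tau>\<^sub>\<theta>
      + (\<tau>\<^sub>g / T * response_coefficient K x \<gamma>)\<^sup>2 / \<tau>\<^sub>g + (\<Sum>k=1..K. (\<tau>\<^sub>y / T * (x k * \<gamma> k))\<^sup>2) / \<tau>\<^sub>y"
    by (simp only: expectation_lin_mult power2_eq_square)
  also have "(\<Sum>k=1..K. (\<tau>\<^sub>y / T * (x k * \<gamma> k))\<^sup>2) / \<tau>\<^sub>y = var_idio * (\<Sum>k=1..K. (x k * \<gamma> k)\<^sup>2)"
    unfolding power_mult_distrib[of "\<tau>\<^sub>y / T"] sum_distrib_left[symmetric]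
    using pos by (simp add: var_idio_def power2_eq_square)
  also have "((\<tau>\<^sub>g + \<tau>\<^sub>y) / T * response_coefficient K x \<gamma>)\<^sup>2 / \<tau>\<^sub>\<theta>
      + (\<tau>\<^sub>g / T * response_coefficient K x \<gamma>)\<^sup>2 / \<tau>\<^sub>g = var_common * (response_coefficient K x \<gamma>)\<^sup>2"
    by (rule var_common_scaled)
  finally show ?thesis .
qed

lemma variance_posterior_mean:
  "k \<in> {1..K} \<Longrightarrow> variance (m k) = var_common + var_idio"
  using posterior_mean_moments by (simp add: power2_eq_square)

end

section \<open>Majorization and the weighted response\<close>

text \<open>Abel summation as an induction: lowering the weight from \<open>c n\<close> to
  \<open>c (Suc n)\<close> on a nonnegative partial sum can only decrease it. In the end the last
  weight multiplies the total 0, whatever its sign.\<close>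

lemma sum_mult_antimono_nonneg:
  fixes c e :: "nat \<Rightarrow> real"
  assumes anti: "\<And>i j. i \<le> j \<Longrightarrow> j < N \<Longrightarrow> c j \<le> c i"
    and partial: "\<And>n. n \<le> N \<Longrightarrow> 0 \<le> (\<Sum>i<n. e i)" and total: "(\<Sum>i<N. e i) = 0"
  shows "0 \<le> (\<Sum>i<N. c i * e i)"
proof -
  have step: "c n * (\<Sum>i<Suc n. e i) \<le> (\<Sum>i<Suc n. c i * e i)" if "n < N" for n
    using that
  proof (induction n)
    case (Suc n)
    have "c (Suc n) * (\<Sum>i<Suc n. e i) \<le> c n * (\<Sum>i<Suc n. e i)"
      using Suc.prems by (intro mult_right_mono anti partial) auto
    also have "\<dots> \<le> (\<Sum>i<Suc n. c i * e i)"
      using Suc by simp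
    finally show ?case
      by (simp add: distrib_left)
  qed simp
  show ?thesis
  proof (cases N)
    case (Suc n)
    then show ?thesis
      using step[of n] total by simp
  qed simp
qed

lemma sum_largest_eq_sum_nth:
  "n \<le> K \<Longrightarrow> sum_largest K n x = (\<Sum>i<n. rev (sort (map x [1..<Suc K])) ! i)"
  unfolding sum_largest_def by (simp add: sum_list_sum_nth atLeast0LessThan)

lemma sum_eq_sum_nth_rev_sort:
  fixes x :: "nat \<Rightarrow> real" and f :: "real \<Rightarrow> real"
  shows "(\<Sum>k=1..K. f (x k)) = (\<Sum>i<K. f (rev (sort (map x [1..<Suc K])) ! i))"
proof -
  let ?ys = "rev (sort (map x [1..<Suc K]))"
  have "(\<Sum>i<K. f (?ys ! i)) = sum_list (map f ?ys)"
    by (simp add: sum_list_sum_nth atLeast0LessThan del: upt_Suc)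
  also have "\<dots> = sum_mset (image_mset f (mset ?ys))"
    by (simp only: sum_mset_sum_list[symmetric] mset_map)
  also have "mset ?ys = mset (map x [1..<Suc K])"
    by simp
  also have "sum_mset (image_mset f \<dots>) = sum_list (map f (map x [1..<Suc K]))"
    by (simp only: sum_mset_sum_list[symmetric] mset_map)
  also have "\<dots> = (\<Sum>k=1..K. f (x k))"
    by (simp add: interv_sum_list_conv_sum_set_nat atLeastLessThanSuc_atLeastAtMost del: upt_Suc)
  finally show ?thesis ..
qed

text \<open>Karamata's inequality from supporting lines. With both vectors sorted in descending
  order, the differences have nonnegative partial sums and total 0, and the slopes \<open>f'\<close>
  at the entries of the majorized vector descend as well, so Abel summation applies; the tangent
  bound finishes term by term. Here \<open>f'\<close> is any monotone choice of supporting slopes,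
  and no differentiability enters.\<close>

lemma majorizes_sum_mono:
  fixes f f' :: "real \<Rightarrow> real"
  assumes maj: "majorizes K x' x"
    and x: "\<And>k. k \<in> {1..K} \<Longrightarrow> x k \<in> I" and x': "\<And>k. k \<in> {1..K} \<Longrightarrow> x' k \<in> I"
    and tangent: "\<And>a b. a \<in> I \<Longrightarrow> b \<in> I \<Longrightarrow> f a + f' a * (b - a) \<le> f b"
    and mono: "mono_on I f'"
  shows "(\<Sum>k=1..K. f (x k)) \<le> (\<Sum>k=1..K. f (x' k))"
proof -
  let ?y = "\<lambda>i. rev (sort (map x [1..<Suc K])) ! i" and ?y' = "\<lambda>i. rev (sort (map x' [1..<Suc K])) ! i"
  have yI: "?y i \<in> I" "?y' i \<in> I" if "i < K" for i
  proof -
    have "?y i \<in> set (rev (sort (map x [1..<Suc K])))" "?y' i \<in> set (rev (sort (map x' [1..<Suc K])))"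
      using that by (intro nth_mem; simp)+
    then show "?y i \<in> I" "?y' i \<in> I"
      using x x' by (auto simp del: upt_Suc)
  qed
  have desc: "?y j \<le> ?y i" if "i \<le> j" "j < K" for i j
    using that by (intro sorted_rev_nth_mono) (auto simp del: upt_Suc)
  have diff: "(\<Sum>i<n. ?y' i - ?y i) = sum_largest K n x' - sum_largest K n x" if "n \<le> K" for n
    using that by (simp add: sum_subtractf sum_largest_eq_sum_nth del: upt_Suc)
  have "0 \<le> (\<Sum>i<K. f' (?y i) * (?y' i - ?y i))"
  proof (rule sum_mult_antimono_nonneg)
    show "f' (?y j) \<le> f' (?y i)" if "i \<le> j" "j < K" for i j
      using that yI by (intro mono_onD[OF mono] desc) auto
    show "0 \<le> (\<Sum>i<n. ?y' i - ?y i)" if "n \<le> K" for n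
      using maj that unfolding diff[OF that] majorizes_def by simp
    show "(\<Sum>i<K. ?y' i - ?y i) = 0"
      using maj unfolding diff[OF order_refl] majorizes_def by simp
  qed
  also have "\<dots> \<le> (\<Sum>i<K. f (?y' i) - f (?y i))"
    using tangent yI by (intro sum_mono) (simp add: le_diff_eq add.commute del: upt_Suc)
  finally show ?thesis
    unfolding sum_eq_sum_nth_rev_sort sum_subtractf by simp
qed

lemma share_vector_bounds:
  assumes "share_vector K x" "k \<in> {1..K}"
  shows "0 \<le> x k" "x k \<le> 1"
proof -
  show "0 \<le> x k" using assms by (auto simp: share_vector_def)
  have "x k \<le> (\<Sum>j=1..K. x j)"
    using assms by (intro member_le_sum) (auto simp: share_vector_def)
  then show "x k \<le> 1" using assms by (simp add: share_vector_def)
qed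

lemma sum_dominant_shares:
  assumes "2 \<le> K"
  shows "(\<Sum>k=1..K. h (dominant_shares K s k)) = h s + (real K - 1) * h ((1 - s) / (real K - 1))"
proof -
  have "(\<Sum>k=Suc 1..K. h (dominant_shares K s k)) = (\<Sum>k=Suc 1..K. h ((1 - s) / (real K - 1)))"
    by (intro sum.cong) (auto simp: dominant_shares_def)
  then show ?thesis
    using assms by (subst sum.atLeast_Suc_atMost) (simp_all add: dominant_shares_def of_nat_diff)
qed

lemma share_vector_dominant_shares:
  assumes "2 \<le> K" "0 \<le> s" "s \<le> 1"
  shows "share_vector K (dominant_shares K s)"
  using assms sum_dominant_shares[of K "\<lambda>x. x" s] by (auto simp: share_vector_def dominant_shares_def)

section \<open>Monotonicity and convexity of the weighted response\<close>

definition weighted_response :: "real \<Rightarrow> real \<Rightarrow> real \<Rightarrow> real" where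
  "weighted_response D \<delta> x = x / (D - \<delta> * x)"

context
  fixes D \<delta> :: real
  assumes D: "0 < \<delta>" "\<delta> < D"
begin

lemma denominator_pos: "x \<le> 1 \<Longrightarrow> 0 < D - \<delta> * x"
  using D by (smt (verit) mult_left_le)

lemma weighted_response_nonneg: "0 \<le> x \<Longrightarrow> x \<le> 1 \<Longrightarrow> 0 \<le> weighted_response D \<delta> x"
  using denominator_pos[of x] by (simp add: weighted_response_def)

text \<open>Monotonicity, the tangent inequality and the strict gain along the dominant-provider
  family are all read off from this exact difference.\<close>

lemma weighted_response_diff:
  assumes "a \<le> 1" "b \<le> 1"
  shows "weighted_response D \<delta> b - weighted_response D \<delta> a = D * (b - a) / ((D - \<delta> * a) * (D - \<delta> * b))"
  using denominator_pos[OF assms(1)] denominator_pos[OF assms(2)]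
  by (simp add: weighted_response_def diff_frac_eq) (simp add: algebra_simps)

lemma weighted_response_mono:
  assumes "a \<le> b" "b \<le> 1"
  shows "weighted_response D \<delta> a \<le> weighted_response D \<delta> b"
proof -
  have "0 \<le> D * (b - a) / ((D - \<delta> * a) * (D - \<delta> * b))"
    using assms D denominator_pos[of a] denominator_pos[of b] by simp
  then show ?thesis
    using weighted_response_diff[of a b] assms by simp
qed

text \<open>The gap between the function and its tangent is
  \<open>D * \<delta> * (b - a)^2 / (p^2 * q)\<close>, with \<open>p\<close> and \<open>q\<close>
  the positive denominators at \<open>a\<close> and \<open>b\<close>.\<close>

lemma weighted_response_tangent:
  assumes "a \<le> 1" "b \<le> 1"
  shows "weighted_response D \<delta> a + D / (D - \<delta> * a)\<^sup>2 * (b - a) \<le> weighted_response D \<delta> b"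
proof -
  define p q where "p = D - \<delta> * a" and "q = D - \<delta> * b"
  have pq: "0 < p" "0 < q" using denominator_pos assms by (simp_all add: p_def q_def)
  have "D * (b - a) / (p * q) - D / p\<^sup>2 * (b - a) = D * (b - a) * (p - q) / (p\<^sup>2 * q)"
    using pq by (simp add: field_simps power2_eq_square)
  also have "\<dots> = D * \<delta> * (b - a)\<^sup>2 / (p\<^sup>2 * q)"
    by (simp add: p_def q_def algebra_simps power2_eq_square)
  also have "\<dots> \<ge> 0"
    using D pq by simp
  finally show ?thesis
    using weighted_response_diff[OF assms] by (simp add: p_def q_def)
qed

lemma weighted_response_deriv_mono: "mono_on {0..1} (\<lambda>a. D / (D - \<delta> * a)\<^sup>2)"
proof (rule mono_onI)
  fix a b :: real assume ab: "a \<in> {0..1}" "b \<in> {0..1}" "a \<le> b"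
  have "(D - \<delta> * b)\<^sup>2 \<le> (D - \<delta> * a)\<^sup>2"
    using ab D denominator_pos[of b] by (intro power_mono) auto
  then show "D / (D - \<delta> * a)\<^sup>2 \<le> D / (D - \<delta> * b)\<^sup>2"
    using ab D denominator_pos[of b] denominator_pos[of a] by (intro divide_left_mono) auto
qed

lemma majorizes_sum_weighted_response:
  assumes "share_vector K x" "share_vector K x'" "majorizes K x' x"
  shows "(\<Sum>k=1..K. weighted_response D \<delta> (x k)) \<le> (\<Sum>k=1..K. weighted_response D \<delta> (x' k))"
    and "(\<Sum>k=1..K. (weighted_response D \<delta> (x k))\<^sup>2) \<le> (\<Sum>k=1..K. (weighted_response D \<delta> (x' k))\<^sup>2)"
proof -
  have I: "x k \<in> {0..1}" "x' k \<in> {0..1}" if "k \<in> {1..K}" for k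
    using share_vector_bounds that assms by auto
  show "(\<Sum>k=1..K. weighted_response D \<delta> (x k)) \<le> (\<Sum>k=1..K. weighted_response D \<delta> (x' k))"
    by (rule majorizes_sum_mono[OF assms(3), of "{0..1}"])
       (use I weighted_response_tangent weighted_response_deriv_mono in auto)
  show "(\<Sum>k=1..K. (weighted_response D \<delta> (x k))\<^sup>2) \<le> (\<Sum>k=1..K. (weighted_response D \<delta> (x' k))\<^sup>2)"
  proof (rule majorizes_sum_mono[OF assms(3), of "{0..1}"])
    show "x k \<in> {0..1}" "x' k \<in> {0..1}" if "k \<in> {1..K}" for k
      using I that by auto
    fix a b :: real assume ab: "a \<in> {0..1}" "b \<in> {0..1}"
    let ?f = "weighted_response D \<delta>"
    \<comment> \<open>A tangent inequality for the square by the chain rule: the one for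
      \<open>?f\<close> is multiplied by \<open>2 * ?f a\<close>, which is nonnegative on the unit
      interval, and then combined with the tangent inequality of squaring.\<close>
    have "2 * ?f a * (D / (D - \<delta> * a)\<^sup>2 * (b - a)) \<le> 2 * ?f a * (?f b - ?f a)"
      using weighted_response_tangent[of a b] weighted_response_nonneg[of a] ab
      by (intro mult_left_mono) auto
    also have "\<dots> \<le> (?f b)\<^sup>2 - (?f a)\<^sup>2"
      using zero_le_power2[of "?f b - ?f a"] by (simp add: power2_eq_square algebra_simps)
    finally show "(?f a)\<^sup>2 + (2 * ?f a * (D / (D - \<delta> * a)\<^sup>2)) * (b - a) \<le> (?f b)\<^sup>2"
      by simp
  next
    show "mono_on {0..1} (\<lambda>a. 2 * weighted_response D \<delta> a * (D / (D - \<delta> * a)\<^sup>2))"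
    proof (rule mono_onI)
      fix a b :: real assume "a \<in> {0..1}" "b \<in> {0..1}" "a \<le> b"
      then show "2 * weighted_response D \<delta> a * (D / (D - \<delta> * a)\<^sup>2)
          \<le> 2 * weighted_response D \<delta> b * (D / (D - \<delta> * b)\<^sup>2)"
        using weighted_response_nonneg[of a] weighted_response_nonneg[of b] weighted_response_mono[of a b] D
        by (intro mult_mono mono_onD[OF weighted_response_deriv_mono]) auto
    qed
  qed
qed

text \<open>The dominant share gains exactly what the \<open>n\<close> small ones lose in total,
  \<open>s' - s\<close>. The small shares \<open>t\<close>, \<open>t'\<close> lie below
  \<open>s\<close>, \<open>s'\<close>, so their denominators are larger and the response they lose
  is strictly smaller than the response gained.\<close>

lemma sum_weighted_response_dominant_shares:
  assumes K: "2 \<le> K" and s: "1 / real K < s" "s < s'" "s' < 1"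
  shows "(\<Sum>k=1..K. weighted_response D \<delta> (dominant_shares K s k))
      < (\<Sum>k=1..K. weighted_response D \<delta> (dominant_shares K s' k))"
    and "(\<Sum>k=1..K. (weighted_response D \<delta> (dominant_shares K s k))\<^sup>2)
      \<le> (\<Sum>k=1..K. (weighted_response D \<delta> (dominant_shares K s' k))\<^sup>2)"
proof -
  let ?f = "weighted_response D \<delta>"
  define n where "n = real K - 1"
  have n: "0 < n" using K by (simp add: n_def)
  define t t' where "t = (1 - s) / n" and "t' = (1 - s') / n"
  \<comment> \<open>\<open>s > 1 / K\<close> says precisely that the first provider is larger than
    each of the others.\<close>
  have "1 < s * (n + 1)" using s(1) K by (simp add: n_def field_simps)
  then have ts: "t < s" using n by (simp add: t_def divide_less_eq algebra_simps)
  have t't: "t' < t" using s n by (simp add: t_def t'_def divide_strict_right_mono)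
  have t'0: "0 < t'" using s n by (simp add: t'_def)
  have nt: "n * (t - t') = s' - s" using n by (simp add: t_def t'_def field_simps)
  have den: "0 < D - \<delta> * s" "0 < D - \<delta> * s'" "0 < D - \<delta> * t" "0 < D - \<delta> * t'"
    using denominator_pos s ts t't by simp_all
  have "n * (?f t - ?f t') = D * (s' - s) / ((D - \<delta> * t') * (D - \<delta> * t))"
    using weighted_response_diff[of t' t] ts t't s nt[symmetric] by simp
  also have "\<dots> < D * (s' - s) / ((D - \<delta> * s) * (D - \<delta> * s'))"
    using den D s ts t't by (intro divide_strict_left_mono mult_strict_mono' mult_pos_pos) auto
  also have "\<dots> = ?f s' - ?f s"
    using weighted_response_diff[of s s'] s by simp
  finally have lt: "n * (?f t - ?f t') < ?f s' - ?f s" .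
  then show "(\<Sum>k=1..K. ?f (dominant_shares K s k)) < (\<Sum>k=1..K. ?f (dominant_shares K s' k))"
    unfolding sum_dominant_shares[OF K] n_def[symmetric] t_def[symmetric] t'_def[symmetric]
    by (simp add: algebra_simps)
  \<comment> \<open>Differences of squares: the inequality \<open>lt\<close> is multiplied by the
    ordered sums \<open>?f t + ?f t' \<le> ?f s' + ?f s\<close>.\<close>
  have "n * (?f t - ?f t') * (?f t + ?f t') \<le> (?f s' - ?f s) * (?f s' + ?f s)"
    using lt n s ts t't t'0 weighted_response_mono[of t' t] weighted_response_mono[of s s']
      weighted_response_mono[of t s] weighted_response_mono[of t' s]
      weighted_response_nonneg[of t] weighted_response_nonneg[of t']
    by (intro mult_mono) auto
  then have "n * ((?f t)\<^sup>2 - (?f t')\<^sup>2) \<le> (?f s')\<^sup>2 - (?f s)\<^sup>2"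
    by (simp add: power2_eq_square algebra_simps)
  then show "(\<Sum>k=1..K. (?f (dominant_shares K s k))\<^sup>2) \<le> (\<Sum>k=1..K. (?f (dominant_shares K s' k))\<^sup>2)"
    unfolding sum_dominant_shares[OF K, of "\<lambda>x. (?f x)\<^sup>2"]
      n_def[symmetric] t_def[symmetric] t'_def[symmetric]
    by (simp add: algebra_simps)
qed

end

section \<open>Equilibrium and comparative statics\<close>

lemma divide_one_minus_mult_mono:
  fixes t y z :: real
  assumes "0 \<le> t" "t * z < 1" "0 \<le> y" "y \<le> z"
  shows "y / (1 - t * y) \<le> z / (1 - t * z)"
  using assms mult_left_mono[of y z t] by (intro frac_le) auto

lemma divide_one_minus_mult_strict_mono:
  fixes t y z :: real
  assumes "0 \<le> t" "t * z < 1" "0 \<le> y" "y < z"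
  shows "y / (1 - t * y) < z / (1 - t * z)"
  using assms mult_left_mono[of y z t] by (intro frac_less) auto

locale delegation_game = signal_model +
  fixes \<psi> c \<xi> \<beta> d :: real
  assumes payoff_pos: "0 < \<xi>" "0 < d" "d < \<beta>"
begin

definition \<delta> :: real where "\<delta> = d * (1 - \<rho>)"

definition \<Lambda> :: "(nat \<Rightarrow> real) \<Rightarrow> real" where
  "\<Lambda> x = (\<Sum>k=1..K. weighted_response (2 * \<beta>) \<delta> (x k))"

lemma delta_bounds: "0 < \<delta>" "\<delta> < 2 * \<beta>"
proof -
  show "0 < \<delta>" using payoff_pos rho_bounds by (simp add: \<delta>_def)
  have "\<delta> < d" using payoff_pos rho_bounds by (simp add: \<delta>_def)
  then show "\<delta> < 2 * \<beta>" using payoff_pos by simp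
qed

lemma Lambda_nonneg:
  assumes "share_vector K x"
  shows "0 \<le> \<Lambda> x"
  unfolding \<Lambda>_def
  using share_vector_bounds[OF assms] weighted_response_nonneg[OF delta_bounds] by (intro sum_nonneg) auto

text \<open>Replacing each share in a denominator by 1 gives
  \<open>\<Lambda> x \<le> 1 / (2 * \<beta> - \<delta>)\<close>, and
  \<open>d * \<rho> < 2 * \<beta> - \<delta>\<close> because
  \<open>d * \<rho> + \<delta> = d < 2 * \<beta>\<close>. The feedback through the aggregate is thus
  a contraction.\<close>

lemma Lambda_bound:
  assumes x: "share_vector K x"
  shows "d * \<rho> * \<Lambda> x < 1"
proof -
  have p: "0 < 2 * \<beta> - \<delta>" using delta_bounds by simp
  have "\<Lambda> x \<le> (\<Sum>k=1..K. x k / (2 * \<beta> - \<delta>))"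
    unfolding \<Lambda>_def weighted_response_def
  proof (rule sum_mono)
    fix k assume "k \<in> {1..K}"
    then have k: "0 \<le> x k" "x k \<le> 1" using share_vector_bounds[OF x] by auto
    then have "\<delta> * x k \<le> \<delta>" using delta_bounds by (simp add: mult_left_le)
    then show "x k / (2 * \<beta> - \<delta> * x k) \<le> x k / (2 * \<beta> - \<delta>)"
      using k p by (intro divide_left_mono) auto
  qed
  also have "\<dots> = 1 / (2 * \<beta> - \<delta>)"
    using x by (simp add: share_vector_def sum_divide_distrib[symmetric])
  finally have "d * \<rho> * \<Lambda> x \<le> d * \<rho> * (1 / (2 * \<beta> - \<delta>))"
    using payoff_pos rho_bounds by (intro mult_left_mono) auto
  also have "\<dots> < 1"
    using p payoff_pos by (simp add: \<delta>_def field_simps)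
  finally show ?thesis .
qed

lemma denom_pos:
  assumes "share_vector K x" "k \<in> {1..K}"
  shows "0 < 2 * \<beta> - \<delta> * x k"
  using denominator_pos[OF delta_bounds] share_vector_bounds[OF assms] by blast

text \<open>The restriction follows the normalisation outside \<open>{1..K}\<close> in
  \<open>affine_equilibrium\<close>, so that uniqueness becomes an equality of functions; likewise
  for \<open>slope\<close>.\<close>

definition intercept :: "nat \<Rightarrow> real" where
  "intercept = restrict (\<lambda>_. (\<psi> + \<beta> * c) / (2 * \<beta> - d)) {1..K}"

definition slope :: "(nat \<Rightarrow> real) \<Rightarrow> nat \<Rightarrow> real" where
  "slope x = restrict (\<lambda>k. \<xi> / (1 - d * \<rho> * \<Lambda> x) / (2 * \<beta> - \<delta> * x k)) {1..K}"

lemma share_mult_slope: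
  "k \<in> {1..K} \<Longrightarrow>
    x k * slope x k = \<xi> / (1 - d * \<rho> * \<Lambda> x) * weighted_response (2 * \<beta>) \<delta> (x k)"
  by (simp add: slope_def weighted_response_def)

lemma response_coefficient_slope:
  "response_coefficient K x (slope x) = \<xi> * (\<Lambda> x / (1 - d * \<rho> * \<Lambda> x))"
proof -
  have "response_coefficient K x (slope x)
      = (\<Sum>k=1..K. \<xi> / (1 - d * \<rho> * \<Lambda> x) * weighted_response (2 * \<beta>) \<delta> (x k))"
    unfolding response_coefficient_def by (intro sum.cong share_mult_slope) auto
  then show ?thesis
    unfolding sum_distrib_left[symmetric] \<Lambda>_def[symmetric] by simp
qed

text \<open>Providers interact only through one share-weighted mean of the intercepts and one of the
  slopes. With such a mean treated as a parameter every equation is solved on its own, and the mean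
  itself solves a scalar linear equation with nonzero coefficient.\<close>

lemma affine_equilibrium_unique:
  assumes x: "share_vector K x"
  shows "affine_equilibrium M K m \<psi> \<xi> c \<beta> d x \<alpha> \<gamma> \<longleftrightarrow> \<alpha> = intercept \<and> \<gamma> = slope x"
proof -
  have \<beta>: "0 < \<beta>" "0 < 2 * \<beta> - d" using payoff_pos by simp_all
  have sum1: "(\<Sum>k=1..K. x k) = 1" using x by (simp add: share_vector_def)
  have L: "0 < 1 - d * \<rho> * \<Lambda> x" using Lambda_bound[OF x] by simp
  have intercepts: "(\<forall>k\<in>{1..K}. 2 * \<beta> * \<alpha> k = \<psi> + \<beta> * c + d * (\<Sum>j=1..K. x j * \<alpha> j))
      \<longleftrightarrow> (\<forall>k\<in>{1..K}. \<alpha> k = (\<psi> + \<beta> * c) / (2 * \<beta> - d))" (is "?L \<longleftrightarrow> ?R")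
  proof
    assume ?R
    then have "(\<Sum>j=1..K. x j * \<alpha> j) = (\<Sum>j=1..K. x j * ((\<psi> + \<beta> * c) / (2 * \<beta> - d)))"
      by (intro sum.cong) auto
    also have "\<dots> = (\<psi> + \<beta> * c) / (2 * \<beta> - d)"
      unfolding sum_distrib_right[symmetric] sum1 by simp
    finally have s: "(\<Sum>j=1..K. x j * \<alpha> j) = (\<psi> + \<beta> * c) / (2 * \<beta> - d)" .
    have "2 * \<beta> * q = \<psi> + \<beta> * c + d * q" if "q = (\<psi> + \<beta> * c) / (2 * \<beta> - d)" for q
      using that \<beta> by (simp add: eq_divide_eq algebra_simps)
    then show ?L
      unfolding s using \<open>?R\<close> by simp
  next
    assume ?L
    \<comment> \<open>All intercepts are the same expression in \<open>a\<close>; averaging with the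
      shares, which sum to 1, leaves one equation for \<open>a\<close>.\<close>
    define a where "a = (\<Sum>j=1..K. x j * \<alpha> j)"
    have \<alpha>: "\<alpha> k = (\<psi> + \<beta> * c + d * a) / (2 * \<beta>)" if "k \<in> {1..K}" for k
      using \<open>?L\<close> that \<beta> by (simp add: a_def field_simps)
    then have "a = (\<Sum>j=1..K. x j * ((\<psi> + \<beta> * c + d * a) / (2 * \<beta>)))"
      unfolding a_def[symmetric] by (subst a_def) (intro sum.cong, auto)
    also have "\<dots> = (\<psi> + \<beta> * c + d * a) / (2 * \<beta>)"
      unfolding sum_distrib_right[symmetric] sum1 by simp
    finally have a: "a = (\<psi> + \<beta> * c + d * a) / (2 * \<beta>)" .
    then have "a = (\<psi> + \<beta> * c) / (2 * \<beta> - d)"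
      using \<beta> by (simp add: field_simps)
    with a \<alpha> show ?R
      by metis
  qed
  have slopes: "(\<forall>k\<in>{1..K}. 2 * \<beta> * \<gamma> k = \<xi> + d * (\<rho> * (\<Sum>j=1..K. x j * \<gamma> j) + (1 - \<rho>) * x k * \<gamma> k))
      \<longleftrightarrow> (\<forall>k\<in>{1..K}. \<gamma> k = slope x k)" (is "?L \<longleftrightarrow> ?R")
  proof -
    \<comment> \<open>For fixed \<open>s\<close> the own term
      \<open>(1 - \<rho>) * x k * \<gamma> k\<close> moves to the left and produces the denominator
      \<open>2 * \<beta> - \<delta> * x k\<close>. Consistency then reads
      \<open>s = (\<xi> + d * \<rho> * s) * \<Lambda> x\<close>.\<close>
    define s where "s = (\<Sum>j=1..K. x j * \<gamma> j)"
    have "?L \<longleftrightarrow> (\<forall>k\<in>{1..K}. \<gamma> k = (\<xi> + d * \<rho> * s) / (2 * \<beta> - \<delta> * x k))"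
    proof (rule ball_cong[OF refl])
      fix k assume "k \<in> {1..K}"
      then have "0 < 2 * \<beta> - \<delta> * x k" by (rule denom_pos[OF x])
      then have "\<gamma> k = (\<xi> + d * \<rho> * s) / (2 * \<beta> - \<delta> * x k)
          \<longleftrightarrow> \<gamma> k * (2 * \<beta> - \<delta> * x k) = \<xi> + d * \<rho> * s"
        by (simp add: eq_divide_eq)
      also have "\<dots> \<longleftrightarrow> 2 * \<beta> * \<gamma> k = \<xi> + d * (\<rho> * (\<Sum>j=1..K. x j * \<gamma> j) + (1 - \<rho>) * x k * \<gamma> k)"
        unfolding s_def[symmetric] \<delta>_def by (auto simp: algebra_simps)
      finally show "2 * \<beta> * \<gamma> k = \<xi> + d * (\<rho> * (\<Sum>j=1..K. x j * \<gamma> j) + (1 - \<rho>) * x k * \<gamma> k)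
          \<longleftrightarrow> \<gamma> k = (\<xi> + d * \<rho> * s) / (2 * \<beta> - \<delta> * x k)" ..
    qed
    also have "\<dots> \<longleftrightarrow> ?R"
    proof
      assume \<gamma>: "\<forall>k\<in>{1..K}. \<gamma> k = (\<xi> + d * \<rho> * s) / (2 * \<beta> - \<delta> * x k)"
      have "s = (\<Sum>j=1..K. (\<xi> + d * \<rho> * s) * weighted_response (2 * \<beta>) \<delta> (x j))"
        by (subst s_def) (intro sum.cong, auto simp: \<gamma> weighted_response_def)
      then have "s = (\<xi> + d * \<rho> * s) * \<Lambda> x"
        unfolding \<Lambda>_def sum_distrib_left[symmetric] .
      then have "(\<xi> + d * \<rho> * s) * (1 - d * \<rho> * \<Lambda> x) = \<xi>"
        by (simp add: algebra_simps)
      then have "\<xi> + d * \<rho> * s = \<xi> / (1 - d * \<rho> * \<Lambda> x)"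
        using L by (simp add: eq_divide_eq)
      with \<gamma> show ?R by (simp add: slope_def)
    next
      assume R: ?R
      then have "s = response_coefficient K x (slope x)"
        unfolding s_def response_coefficient_def by (intro sum.cong) auto
      then have "s = \<xi> * (\<Lambda> x / (1 - d * \<rho> * \<Lambda> x))"
        by (simp only: response_coefficient_slope)
      then have "\<xi> + d * \<rho> * s = \<xi> / (1 - d * \<rho> * \<Lambda> x)"
        using L by (simp add: field_simps)
      with R show "\<forall>k\<in>{1..K}. \<gamma> k = (\<xi> + d * \<rho> * s) / (2 * \<beta> - \<delta> * x k)"
        by (simp add: slope_def)
    qed
    finally show ?thesis .
  qed
  have ext: "f = restrict g {1..K} \<longleftrightarrow> f \<in> extensional {1..K} \<and> (\<forall>k\<in>{1..K}. f k = g k)"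
    for f g :: "nat \<Rightarrow> real"
    by (auto intro!: extensionalityI[of _ "{1..K}"])
  have "slope x = restrict (slope x) {1..K}"
    by (simp add: slope_def)
  then show ?thesis
    unfolding affine_equilibrium_iff[OF \<beta>(1)] ball_conj_distrib intercepts slopes intercept_def
    by (metis ext)
qed

lemma expectation_aggregate_intercept:
  assumes "share_vector K x"
  shows "expectation (aggregate_action K m x intercept \<gamma>) = (\<psi> + \<beta> * c) / (2 * \<beta> - d)"
proof -
  have "(\<Sum>k=1..K. x k * intercept k) = (\<Sum>k=1..K. x k) * ((\<psi> + \<beta> * c) / (2 * \<beta> - d))"
    unfolding sum_distrib_right by (intro sum.cong) (auto simp: intercept_def)
  then show ?thesis
    using assms by (simp add: expectation_aggregate_action share_vector_def)
qed

lemma response_coefficient_slope_nonneg: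
  "share_vector K x \<Longrightarrow> 0 \<le> response_coefficient K x (slope x)"
  unfolding response_coefficient_slope
  using Lambda_nonneg[of x] Lambda_bound[of x] payoff_pos by simp

lemma
  assumes x: "share_vector K x" and x': "share_vector K x'"
  shows response_coefficient_mono: "\<Lambda> x \<le> \<Lambda> x' \<Longrightarrow>
      response_coefficient K x (slope x) \<le> response_coefficient K x' (slope x')"
    and response_coefficient_strict_mono: "\<Lambda> x < \<Lambda> x' \<Longrightarrow>
      response_coefficient K x (slope x) < response_coefficient K x' (slope x')"
  unfolding response_coefficient_slope mult_le_cancel_left_pos[OF payoff_pos(1)]
    mult_less_cancel_left_pos[OF payoff_pos(1)]
  using payoff_pos rho_bounds Lambda_nonneg[OF x] Lambda_bound[OF x']
    divide_one_minus_mult_mono[of "d * \<rho>" "\<Lambda> x'" "\<Lambda> x"]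
    divide_one_minus_mult_strict_mono[of "d * \<rho>" "\<Lambda> x'" "\<Lambda> x"]
  by simp_all

lemma sum_square_share_slope_mono:
  assumes x: "share_vector K x" and x': "share_vector K x'" and L: "\<Lambda> x \<le> \<Lambda> x'"
    and Q: "(\<Sum>k=1..K. (weighted_response (2 * \<beta>) \<delta> (x k))\<^sup>2)
      \<le> (\<Sum>k=1..K. (weighted_response (2 * \<beta>) \<delta> (x' k))\<^sup>2)"
  shows "(\<Sum>k=1..K. (x k * slope x k)\<^sup>2) \<le> (\<Sum>k=1..K. (x' k * slope x' k)\<^sup>2)"
proof -
  have eq: "(\<Sum>k=1..K. (x k * slope x k)\<^sup>2) = (\<xi> / (1 - d * \<rho> * \<Lambda> x))\<^sup>2
      * (\<Sum>k=1..K. (weighted_response (2 * \<beta>) \<delta> (x k))\<^sup>2)" for x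
    unfolding sum_distrib_left by (intro sum.cong) (auto simp: share_mult_slope power_mult_distrib power_divide)
  have "d * \<rho> * \<Lambda> x \<le> d * \<rho> * \<Lambda> x'"
    using L payoff_pos rho_bounds by (intro mult_left_mono) auto
  then have "\<xi> / (1 - d * \<rho> * \<Lambda> x) \<le> \<xi> / (1 - d * \<rho> * \<Lambda> x')"
    using Lambda_bound[OF x'] payoff_pos by (intro frac_le) auto
  then show ?thesis
    unfolding eq using Q Lambda_bound[OF x] payoff_pos
    by (intro mult_mono power_mono sum_nonneg) auto
qed

text \<open>Strictness is supplied by the common term alone, while the private-noise term grows
  weakly. The intercepts may be arbitrary, as they shift only the mean.\<close>

lemma variance_aggregate_mono:
  assumes x: "share_vector K x" and x': "share_vector K x'"
    and Q: "(\<Sum>k=1..K. (weighted_response (2 * \<beta>) \<delta> (x k))\<^sup>2)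
      \<le> (\<Sum>k=1..K. (weighted_response (2 * \<beta>) \<delta> (x' k))\<^sup>2)"
  shows "\<Lambda> x \<le> \<Lambda> x' \<Longrightarrow> variance (aggregate_action K m x \<alpha> (slope x))
      \<le> variance (aggregate_action K m x' \<alpha>' (slope x'))"
    and "\<Lambda> x < \<Lambda> x' \<Longrightarrow> variance (aggregate_action K m x \<alpha> (slope x))
      < variance (aggregate_action K m x' \<alpha>' (slope x'))"
proof -
  note S0 = response_coefficient_slope_nonneg[OF x]
  show "variance (aggregate_action K m x \<alpha> (slope x)) \<le> variance (aggregate_action K m x' \<alpha>' (slope x'))"
    if "\<Lambda> x \<le> \<Lambda> x'"
    unfolding variance_aggregate_action
    using that S0 response_coefficient_mono[OF x x'] sum_square_share_slope_mono[OF x x' that Q]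
      var_common_pos var_idio_pos
    by (intro add_mono mult_left_mono power_mono) auto
  show "variance (aggregate_action K m x \<alpha> (slope x)) < variance (aggregate_action K m x' \<alpha>' (slope x'))"
    if "\<Lambda> x < \<Lambda> x'"
    unfolding variance_aggregate_action
    using that S0 response_coefficient_strict_mono[OF x x'] sum_square_share_slope_mono[OF x x' _ Q]
      var_common_pos var_idio_pos
    by (intro add_less_le_mono mult_strict_left_mono mult_left_mono power_strict_mono) auto
qed

end

theorem proposition2:
  fixes M :: "'a measure" and K :: nat
    and \<tau>\<^sub>\<theta> \<tau>\<^sub>g \<tau>\<^sub>y \<psi> c \<xi> \<beta> d \<rho> \<alpha>\<^sub>0 :: real
    and \<theta> :: "'a \<Rightarrow> real" and \<eta> m :: "nat \<Rightarrow> 'a \<Rightarrow> real"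
    and A :: "(nat \<Rightarrow> real) \<Rightarrow> (nat \<Rightarrow> real) \<Rightarrow> (nat \<Rightarrow> real) \<Rightarrow> 'a \<Rightarrow> real"
    and S :: "(nat \<Rightarrow> real) \<Rightarrow> (nat \<Rightarrow> real) \<Rightarrow> real"
    and equilibrium :: "(nat \<Rightarrow> real) \<Rightarrow> (nat \<Rightarrow> real) \<Rightarrow> (nat \<Rightarrow> real) \<Rightarrow> bool"
  assumes "0 < \<tau>\<^sub>\<theta>" and "0 < \<tau>\<^sub>g" and "0 < \<tau>\<^sub>y"
    and "0 < \<xi>" and "0 < d" and "d < \<beta>"
    and "signal_structure M K \<tau>\<^sub>\<theta> \<tau>\<^sub>g \<tau>\<^sub>y \<theta> \<eta>"
    and m: "m = posterior_mean M \<theta> \<eta>"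
    and \<rho>: "\<rho> = posterior_corr \<tau>\<^sub>\<theta> \<tau>\<^sub>g \<tau>\<^sub>y"
    and \<alpha>\<^sub>0: "\<alpha>\<^sub>0 = (\<psi> + \<beta> * c) / (2 * \<beta> - d)"
    and A: "A = aggregate_action K m"
    and S: "S = response_coefficient K"
    and equilibrium: "equilibrium = affine_equilibrium M K m \<psi> \<xi> c \<beta> d"
  shows "(\<forall>x. share_vector K x \<longrightarrow> (\<exists>!(\<alpha>, \<gamma>). equilibrium x \<alpha> \<gamma>)) \<and>
    (\<forall>x x' \<alpha> \<gamma> \<alpha>' \<gamma>'.
       share_vector K x \<and> share_vector K x' \<and> majorizes K x' x \<and>
       equilibrium x \<alpha> \<gamma> \<and> equilibrium x' \<alpha>' \<gamma>' \<longrightarrow>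
         (\<forall>k\<in>{1..K}. \<alpha> k = \<alpha>\<^sub>0 \<and> \<alpha>' k = \<alpha>\<^sub>0) \<and>
         prob_space.expectation M (A x \<alpha> \<gamma>) = \<alpha>\<^sub>0 \<and>
         prob_space.expectation M (A x' \<alpha>' \<gamma>') = \<alpha>\<^sub>0 \<and>
         S x \<gamma> \<le> S x' \<gamma>' \<and>
         cov M (A x \<alpha> \<gamma>) \<theta> \<le> cov M (A x' \<alpha>' \<gamma>') \<theta> \<and>
         (\<forall>k\<in>{1..K}. \<rho> * prob_space.variance M (m k) * (S x \<gamma>)\<^sup>2
                        \<le> \<rho> * prob_space.variance M (m k) * (S x' \<gamma>')\<^sup>2) \<and>
         prob_space.variance M (A x \<alpha> \<gamma>) \<le> prob_space.variance M (A x' \<alpha>' \<gamma>')) \<and>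
    (2 \<le> K \<longrightarrow>
      (\<forall>s s' \<alpha> \<gamma> \<alpha>' \<gamma>'.
         1 / real K < s \<and> s < s' \<and> s' < 1 \<and>
         equilibrium (dominant_shares K s) \<alpha> \<gamma> \<and>
         equilibrium (dominant_shares K s') \<alpha>' \<gamma>' \<longrightarrow>
           S (dominant_shares K s) \<gamma> < S (dominant_shares K s') \<gamma>' \<and>
           cov M (A (dominant_shares K s) \<alpha> \<gamma>) \<theta> < cov M (A (dominant_shares K s') \<alpha>' \<gamma>') \<theta> \<and>
           (\<forall>k\<in>{1..K}. \<rho> * prob_space.variance M (m k) * (S (dominant_shares K s) \<gamma>)\<^sup>2
                          < \<rho> * prob_space.variance M (m k) * (S (dominant_shares K s') \<gamma>')\<^sup>2) \<and>
           prob_space.variance M (A (dominant_shares K s) \<alpha> \<gamma>)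
             < prob_space.variance M (A (dominant_shares K s') \<alpha>' \<gamma>')))"
proof -
  interpret prob_space M
    using assms(7) by (simp add: signal_structure_def)
  interpret G: delegation_game M K \<tau>\<^sub>\<theta> \<tau>\<^sub>g \<tau>\<^sub>y \<theta> \<eta> \<psi> c \<xi> \<beta> d
    using assms(1-7) by unfold_locales
  note unique = G.affine_equilibrium_unique
  note eqs = m \<rho> A S equilibrium
  have cov_factor: "0 < (\<tau>\<^sub>g + \<tau>\<^sub>y) / (G.T * \<tau>\<^sub>\<theta>)"
    using assms(1-3) G.T_pos by simp
  have common_factor: "0 < G.\<rho> * variance (G.m k)" if "k \<in> {1..K}" for k
    using G.rho_bounds G.var_common_pos G.var_idio_pos
    unfolding G.variance_posterior_mean[OF that] by simp
  have existence: "\<exists>!(\<alpha>, \<gamma>). equilibrium x \<alpha> \<gamma>" if "share_vector K x" for x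
    unfolding eqs unique[OF that] by auto
  have weak: "(\<forall>k\<in>{1..K}. \<alpha> k = \<alpha>\<^sub>0 \<and> \<alpha>' k = \<alpha>\<^sub>0) \<and>
      expectation (A x \<alpha> \<gamma>) = \<alpha>\<^sub>0 \<and> expectation (A x' \<alpha>' \<gamma>') = \<alpha>\<^sub>0 \<and>
      S x \<gamma> \<le> S x' \<gamma>' \<and> cov M (A x \<alpha> \<gamma>) \<theta> \<le> cov M (A x' \<alpha>' \<gamma>') \<theta> \<and>
      (\<forall>k\<in>{1..K}. \<rho> * variance (m k) * (S x \<gamma>)\<^sup>2 \<le> \<rho> * variance (m k) * (S x' \<gamma>')\<^sup>2) \<and>
      variance (A x \<alpha> \<gamma>) \<le> variance (A x' \<alpha>' \<gamma>')"
    if x: "share_vector K x" and x': "share_vector K x'" and maj: "majorizes K x' x"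
      and eq: "equilibrium x \<alpha> \<gamma>" "equilibrium x' \<alpha>' \<gamma>'" for x x' \<alpha> \<gamma> \<alpha>' \<gamma>'
  proof -
    note sums = majorizes_sum_weighted_response[OF G.delta_bounds x x' maj]
    \<comment> \<open>Uniqueness replaces arbitrary equilibria by the closed form, after which the
      two situations differ only in the share vectors.\<close>
    have sol: "\<alpha> = G.intercept" "\<gamma> = G.slope x" "\<alpha>' = G.intercept" "\<gamma>' = G.slope x'"
      using eq unfolding eqs unique[OF x] unique[OF x'] by auto
    have L: "G.\<Lambda> x \<le> G.\<Lambda> x'"
      using sums(1) by (simp add: G.\<Lambda>_def)
    note S_mono = G.response_coefficient_mono[OF x x' L]
    have "\<forall>k\<in>{1..K}. \<alpha> k = \<alpha>\<^sub>0 \<and> \<alpha>' k = \<alpha>\<^sub>0"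
      by (simp add: sol \<alpha>\<^sub>0 G.intercept_def)
    moreover have "expectation (A x \<alpha> \<gamma>) = \<alpha>\<^sub>0" "expectation (A x' \<alpha>' \<gamma>') = \<alpha>\<^sub>0"
      unfolding eqs sol \<alpha>\<^sub>0 using x x' by (simp_all only: G.expectation_aggregate_intercept)
    moreover have "S x \<gamma> \<le> S x' \<gamma>'"
      unfolding eqs sol by (rule S_mono)
    moreover have "cov M (A x \<alpha> \<gamma>) \<theta> \<le> cov M (A x' \<alpha>' \<gamma>') \<theta>"
      unfolding eqs sol G.cov_aggregate_action
      by (intro mult_left_mono S_mono less_imp_le cov_factor)
    moreover have "\<forall>k\<in>{1..K}. \<rho> * variance (m k) * (S x \<gamma>)\<^sup>2 \<le> \<rho> * variance (m k) * (S x' \<gamma>')\<^sup>2"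
      unfolding eqs sol
      by (intro ballI mult_left_mono power_mono S_mono G.response_coefficient_slope_nonneg[OF x]
          less_imp_le common_factor)
    moreover have "variance (A x \<alpha> \<gamma>) \<le> variance (A x' \<alpha>' \<gamma>')"
      unfolding eqs sol by (rule G.variance_aggregate_mono(1)[OF x x' sums(2) L])
    ultimately show ?thesis
      by blast
  qed
  have strict: "S x \<gamma> < S x' \<gamma>' \<and> cov M (A x \<alpha> \<gamma>) \<theta> < cov M (A x' \<alpha>' \<gamma>') \<theta> \<and>
      (\<forall>k\<in>{1..K}. \<rho> * variance (m k) * (S x \<gamma>)\<^sup>2 < \<rho> * variance (m k) * (S x' \<gamma>')\<^sup>2) \<and>
      variance (A x \<alpha> \<gamma>) < variance (A x' \<alpha>' \<gamma>')"
    if K: "2 \<le> K" and s: "1 / real K < s" "s < s'" "s' < 1"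
      and dom: "x = dominant_shares K s" "x' = dominant_shares K s'"
      and eq: "equilibrium x \<alpha> \<gamma>" "equilibrium x' \<alpha>' \<gamma>'" for s s' x x' \<alpha> \<gamma> \<alpha>' \<gamma>'
  proof -
    have "0 < s" using s(1) K by (smt (verit) divide_nonneg_nonneg of_nat_0_le_iff)
    then have x: "share_vector K x" and x': "share_vector K x'"
      unfolding dom using s K share_vector_dominant_shares by auto
    \<comment> \<open>The direct comparison within the family takes the place of majorization here,
      since it provides a strict inequality for \<Lambda>.\<close>
    note sums = sum_weighted_response_dominant_shares[OF G.delta_bounds K s, folded dom]
    have sol: "\<alpha> = G.intercept" "\<gamma> = G.slope x" "\<alpha>' = G.intercept" "\<gamma>' = G.slope x'"
      using eq unfolding eqs unique[OF x] unique[OF x'] by auto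
    have L: "G.\<Lambda> x < G.\<Lambda> x'"
      using sums(1) by (simp add: G.\<Lambda>_def)
    note S_mono = G.response_coefficient_strict_mono[OF x x' L]
    have "S x \<gamma> < S x' \<gamma>'"
      unfolding eqs sol by (rule S_mono)
    moreover have "cov M (A x \<alpha> \<gamma>) \<theta> < cov M (A x' \<alpha>' \<gamma>') \<theta>"
      unfolding eqs sol G.cov_aggregate_action
      by (intro mult_strict_left_mono S_mono cov_factor)
    moreover have "\<forall>k\<in>{1..K}. \<rho> * variance (m k) * (S x \<gamma>)\<^sup>2 < \<rho> * variance (m k) * (S x' \<gamma>')\<^sup>2"
      unfolding eqs sol
      by (intro ballI mult_strict_left_mono power_strict_mono S_mono
          G.response_coefficient_slope_nonneg[OF x] common_factor) simp_all
    moreover have "variance (A x \<alpha> \<gamma>) < variance (A x' \<alpha>' \<gamma>')"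
      unfolding eqs sol by (rule G.variance_aggregate_mono(2)[OF x x' sums(2) L])
    ultimately show ?thesis
      by blast
  qed
  show ?thesis
  proof (rule conjI[OF _ conjI]; intro allI impI; (elim conjE)?)
  qed (rule existence weak strict[OF _ _ _ _ refl refl]; assumption)+
qed

end
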